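(* If $2n+1>1$, then $B\,\mathrm{J}^+\subsetneq\mathrm{SO}_{2n+1}(F)$.
   Context: $F$ non-archimedean local field of characteristic $0$, ring of integers $\mathcal{O}$, $\mathfrak{p}=\varpi\mathcal{O}$, residue field $k$. $V_n$ has basis $\mathcal{B}_0=(e_1,\dots,e_n,v_0,f_n,\dots,f_1)$ with $\langle e_i,f_j\rangle=\delta_{ij}$, $\langle v_0,v_0\rangle=2$, other pairings $0$, $q(x)=\langle x,x\rangle/2$, $\mathrm{SO}_{2n+1}(F)=\mathrm{SO}(V_n,q)$. $B$ is the standard Borel subgroup (upper triangular elements in $\mathcal{B}_0$). $L=\oplus\mathcal{O}e_i\oplus\oplus\varpi\mathcal{O}f_i\oplus\varpi\mathcal{O}v_0$, $\mathrm{J}=\{g:g(L)=L\}$; for $g\in\mathrm{J}$, reducing its action on $L$ modulo $\mathfrak{p}$ and passing to the quotient of $L/\mathfrak{p}L$ by the kernel (spanned by the image of $\varpi v_0$) of the form induced by $q/\varpi$ gives $\bar g$ in a $2n$-dimensional orthogonal group; $\alpha(g)=\det\bar g$ if $\mathrm{char}\,k\ne2$ and the Dickson–Dieudonné determinant of $\bar g$ if $\mathrm{char}\,k=2$; $\mathrm{J}^+=\ker\alpha$. *)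

theory Defs
  imports "Jordan_Normal_Form.DL_Rank"
begin

section \<open>Non-archimedean local fields of characteristic 0\<close>

text \<open>A (normalised, discrete) valuation is a function v on F whose value at 0 is irrelevant;
  the set of x with x = 0 or N <= v x is the ideal p^N (N = 0: the ring of integers O,
  N = 1: the maximal ideal p).\<close>

definition vball :: "('a::field \<Rightarrow> int) \<Rightarrow> int \<Rightarrow> 'a set" where
  "vball v N = {x. x = 0 \<or> N \<le> v x}"

abbreviation Oring :: "('a::field \<Rightarrow> int) \<Rightarrow> 'a set" where
  "Oring v \<equiv> vball v 0"

abbreviation pideal :: "('a::field \<Rightarrow> int) \<Rightarrow> 'a set" where
  "pideal v \<equiv> vball v 1"

text \<open>F (a type of class field_char_0) with normalised discrete valuation v is a
  non-archimedean local field (complete, finite residue field), and res : O -> k is the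
  reduction map onto the residue field k = O/p (a field type).\<close>

definition nonarch_local_field_char0 ::
  "('a::field_char_0 \<Rightarrow> int) \<Rightarrow> ('a \<Rightarrow> 'k::field) \<Rightarrow> bool" where
  "nonarch_local_field_char0 v res \<longleftrightarrow>
     (\<forall>x y. x \<noteq> 0 \<longrightarrow> y \<noteq> 0 \<longrightarrow> v (x * y) = v x + v y)
   \<and> (\<forall>x y. x \<noteq> 0 \<longrightarrow> y \<noteq> 0 \<longrightarrow> x + y \<noteq> 0 \<longrightarrow> min (v x) (v y) \<le> v (x + y))
   \<and> (\<exists>w. w \<noteq> 0 \<and> v w = 1)
   \<and> (\<forall>s :: nat \<Rightarrow> 'a.
        (\<forall>N. \<exists>M. \<forall>i\<ge>M. \<forall>j\<ge>M. s i - s j \<in> vball v N)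
        \<longrightarrow> (\<exists>l. \<forall>N. \<exists>M. \<forall>i\<ge>M. s i - l \<in> vball v N))
   \<and> (\<forall>x\<in>Oring v. \<forall>y\<in>Oring v. res (x + y) = res x + res y \<and> res (x * y) = res x * res y)
   \<and> res 1 = 1
   \<and> res ` Oring v = UNIV
   \<and> (\<forall>x\<in>Oring v. res x = 0 \<longleftrightarrow> x \<in> pideal v)
   \<and> finite (UNIV :: 'k set)"

section \<open>The quadratic space V_n and SO_{2n+1}(F)\<close>

text \<open>Coordinates w.r.t. B_0 = (e_1,...,e_n,v_0,f_n,...,f_1): index i-1 is e_i, index n is v_0,
  index 2n+1-i is f_i.  Gram matrix of the bilinear form.\<close>

definition gram :: "nat \<Rightarrow> 'a::field mat" where
  "gram n = mat (2*n+1) (2*n+1)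
     (\<lambda>(i,j). if i + j = 2*n then (if i = n then 2 else 1) else 0)"

definition qform :: "nat \<Rightarrow> 'a::field vec \<Rightarrow> 'a" where
  "qform n x = (x \<bullet> (gram n *\<^sub>v x)) / 2"

definition SO_odd :: "nat \<Rightarrow> 'a::field mat set" where
  "SO_odd n = {g \<in> carrier_mat (2*n+1) (2*n+1). det g = 1 \<and>
                 (\<forall>x \<in> carrier_vec (2*n+1). qform n (g *\<^sub>v x) = qform n x)}"

text \<open>Standard Borel: upper triangular elements (w.r.t. B_0).\<close>

definition Borel :: "nat \<Rightarrow> 'a::field mat set" where
  "Borel n = {g \<in> SO_odd n. \<forall>i < 2*n+1. \<forall>j < i. g $$ (i, j) = 0}"

section \<open>The lattice L, its stabiliser J and the subgroup J^+\<close>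

definition lattice_L :: "('a::field \<Rightarrow> int) \<Rightarrow> nat \<Rightarrow> 'a vec set" where
  "lattice_L v n = {x \<in> carrier_vec (2*n+1).
      \<forall>i < 2*n+1. x $ i \<in> (if i < n then Oring v else pideal v)}"

definition J_stab :: "('a::field \<Rightarrow> int) \<Rightarrow> nat \<Rightarrow> 'a mat set" where
  "J_stab v n = {g \<in> SO_odd n. (\<lambda>x. g *\<^sub>v x) ` lattice_L v n = lattice_L v n}"

text \<open>The O-basis (e_1,...,e_n, w v_0, w f_n, ..., w f_1) of L is given by the columns of
  the diagonal matrix Lbasis; the matrix of g on L in this basis is Lbasis^-1 g Lbasis.\<close>

definition Lbasis :: "'a::field \<Rightarrow> nat \<Rightarrow> 'a mat" where
  "Lbasis w n = mat (2*n+1) (2*n+1) (\<lambda>(i,j). if i = j then (if i < n then 1 else w) else 0)"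

definition Lbasis_inv :: "'a::field \<Rightarrow> nat \<Rightarrow> 'a mat" where
  "Lbasis_inv w n = mat (2*n+1) (2*n+1) (\<lambda>(i,j). if i = j then (if i < n then 1 else inverse w) else 0)"

text \<open>g bar: reduce the action of g on L modulo p (matrix over k in the basis of L/pL given by
  the images of the basis above), then pass to the quotient of L/pL by the line spanned by
  the image of w v_0 (index n): the matrix of the induced map on the quotient, in the basis of
  images of the remaining basis vectors, is obtained by deleting row n and column n.\<close>

definition red_bar :: "('a::field \<Rightarrow> 'k::field) \<Rightarrow> 'a \<Rightarrow> nat \<Rightarrow> 'a mat \<Rightarrow> 'k mat" where
  "red_bar res w n g = mat_delete (map_mat res (Lbasis_inv w n * g * Lbasis w n)) n n"

text \<open>Dickson (Dickson--Dieudonne) invariant of an element h of an orthogonal group of a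
  nondegenerate quadratic space of dimension m over a field: rank(h - 1) mod 2 (in Z/2Z,
  represented by 0/1).\<close>

definition dickson_inv :: "nat \<Rightarrow> 'k::field mat \<Rightarrow> nat" where
  "dickson_inv m h = vec_space.rank m (h - 1\<^sub>m m) mod 2"

text \<open>J^+ = ker alpha, with alpha(g) = det(g bar) if char k <> 2 and the Dickson invariant of
  g bar if char k = 2.\<close>

definition J_plus :: "('a::field \<Rightarrow> int) \<Rightarrow> ('a \<Rightarrow> 'k::field) \<Rightarrow> 'a \<Rightarrow> nat \<Rightarrow> 'a mat set" where
  "J_plus v res w n = {g \<in> J_stab v n.
      if (2::'k) \<noteq> 0 then det (red_bar res w n g) = 1
      else dickson_inv (2*n) (red_bar res w n g) = 0}"

end

theory Submission
  imports Defs "HOL-Library.FuncSet" "HOL-Library.Cardinality"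
begin

section \<open>Hyperbolic forms on coordinate functions\<close>

definition window :: "nat \<Rightarrow> nat \<Rightarrow> (nat \<Rightarrow> 'k::field) set" where
  "window m a = {x. \<forall>i. (i < a \<or> 2*m - a \<le> i) \<longrightarrow> x i = 0}"

definition window_part :: "nat \<Rightarrow> nat \<Rightarrow> (nat \<Rightarrow> 'k::field) \<Rightarrow> nat \<Rightarrow> 'k" where
  "window_part m a x = (\<lambda>i. if a \<le> i \<and> i < 2*m - a then x i else 0)"

definition matvec :: "nat \<Rightarrow> (nat \<Rightarrow> nat \<Rightarrow> 'k::field) \<Rightarrow> (nat \<Rightarrow> 'k) \<Rightarrow> nat \<Rightarrow> 'k" where
  "matvec m U x = (\<lambda>i. \<Sum>j<2*m. U i j * x j)"

definition hquad :: "nat \<Rightarrow> (nat \<Rightarrow> 'k::field) \<Rightarrow> 'k" where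
  "hquad m x = (\<Sum>i<m. x i * x (2*m-1-i))"

definition hbil :: "nat \<Rightarrow> (nat \<Rightarrow> 'k::field) \<Rightarrow> (nat \<Rightarrow> 'k) \<Rightarrow> 'k" where
  "hbil m x y = (\<Sum>i<m. x i * y (2*m-1-i) + y i * x (2*m-1-i))"

definition unit_fun :: "nat \<Rightarrow> nat \<Rightarrow> 'k::field" where
  "unit_fun j = (\<lambda>i. if i = j then 1 else 0)"

lemma card_UNIV_field_ge_2:
  assumes "finite (UNIV :: 'k::field set)"
  shows "2 \<le> CARD('k)"
proof -
  have "card {0::'k, 1} \<le> CARD('k)" using assms by (intro card_mono) auto
  then show ?thesis by simp
qed

lemma hbil_commute: "hbil m x y = hbil m y x"
  unfolding hbil_def by (simp add: algebra_simps)

lemma hbil_diff_left: "hbil m (\<lambda>i. x i - y i) z = hbil m x z - hbil m y z"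
  unfolding hbil_def by (simp add: algebra_simps sum_subtractf)

lemma hbil_diff_right: "hbil m z (\<lambda>i. x i - y i) = hbil m z x - hbil m z y"
  unfolding hbil_def by (simp add: algebra_simps sum_subtractf)

lemma hbil_scale_left: "hbil m (\<lambda>i. c * x i) z = c * hbil m x z"
  unfolding hbil_def by (simp add: algebra_simps sum_distrib_left)

lemma hbil_scale_right: "hbil m z (\<lambda>i. c * x i) = c * hbil m z x"
  unfolding hbil_def by (simp add: algebra_simps sum_distrib_left)

lemma hbil_uminus_left: "hbil m (\<lambda>i. - x i) y = - hbil m x y"
  using hbil_scale_left[of m "-1" x y] by simp

lemma hbil_zero_left [simp]: "hbil m (\<lambda>i. 0) y = 0"
  unfolding hbil_def by simp

lemma hbil_zero_right [simp]: "hbil m y (\<lambda>i. 0) = 0"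
  unfolding hbil_def by simp

lemma hbil_self: "hbil m x x = 2 * hquad m x"
  unfolding hquad_def hbil_def by (simp add: algebra_simps sum_distrib_left)

lemma hquad_zero [simp]: "hquad m (\<lambda>i. 0) = 0"
  unfolding hquad_def by simp

lemma hquad_add: "hquad m (\<lambda>i. x i + y i) = hquad m x + hquad m y + hbil m x y"
  unfolding hquad_def hbil_def by (simp add: algebra_simps sum.distrib)

lemma hquad_scale: "hquad m (\<lambda>i. c * x i) = c * c * hquad m x"
  unfolding hquad_def by (simp add: algebra_simps sum_distrib_left)

lemma hquad_diff: "hquad m (\<lambda>i. x i - y i) = hquad m x + hquad m y - hbil m x y"
proof -
  have "hquad m (\<lambda>i. x i + (-1) * y i) =
      hquad m x + hquad m (\<lambda>i. (-1) * y i) + hbil m x (\<lambda>i. (-1) * y i)"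
    by (rule hquad_add)
  then show ?thesis by (simp only: hquad_scale hbil_scale_right) simp
qed

lemma matvec_add: "matvec m U (\<lambda>i. x i + y i) = (\<lambda>i. matvec m U x i + matvec m U y i)"
  unfolding matvec_def by (simp add: algebra_simps sum.distrib)

lemma matvec_diff: "matvec m U (\<lambda>i. x i - y i) = (\<lambda>i. matvec m U x i - matvec m U y i)"
  unfolding matvec_def by (simp add: algebra_simps sum_subtractf)

lemma matvec_scale: "matvec m U (\<lambda>i. c * x i) = (\<lambda>i. c * matvec m U x i)"
  unfolding matvec_def by (simp add: algebra_simps sum_distrib_left)

lemma matvec_zero [simp]: "matvec m U (\<lambda>i. 0) = (\<lambda>i. 0)"
  unfolding matvec_def by simp

lemma matvec_unit_fun: "j < 2*m \<Longrightarrow> matvec m U (unit_fun j) = (\<lambda>i. U i j)"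
  unfolding matvec_def unit_fun_def by (simp add: if_distrib cong: if_cong)

lemma unit_fun_window_0: "j < 2*m \<Longrightarrow> unit_fun j \<in> window m 0"
  unfolding window_def unit_fun_def by auto

lemma window_antimono: "a \<le> b \<Longrightarrow> window m b \<subseteq> window m a"
  unfolding window_def by auto

lemma window_add: "x \<in> window m a \<Longrightarrow> y \<in> window m a \<Longrightarrow> (\<lambda>i. x i + y i) \<in> window m a"
  unfolding window_def by auto

lemma window_diff: "x \<in> window m a \<Longrightarrow> y \<in> window m a \<Longrightarrow> (\<lambda>i. x i - y i) \<in> window m a"
  unfolding window_def by auto

lemma window_scale: "x \<in> window m a \<Longrightarrow> (\<lambda>i. c * x i) \<in> window m a"
  unfolding window_def by auto

lemma window_uminus: "x \<in> window m a \<Longrightarrow> (\<lambda>i. - x i) \<in> window m a"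
  unfolding window_def by auto

lemma window_zero: "(\<lambda>i. 0) \<in> window m a"
  unfolding window_def by auto

lemma window_middle: "window m m = {\<lambda>i. 0}"
  unfolding window_def by (auto simp: fun_eq_iff) (meson not_le)

lemma window_part_in_window: "window_part m a x \<in> window m a"
  unfolding window_def window_part_def by auto

lemma window_part_id: "x \<in> window m a \<Longrightarrow> window_part m a x = x"
  unfolding window_def window_part_def by (auto simp: fun_eq_iff)

lemma window_part_add: "window_part m a (\<lambda>i. x i + y i) = (\<lambda>i. window_part m a x i + window_part m a y i)"
  unfolding window_part_def by auto

lemma window_part_diff: "window_part m a (\<lambda>i. x i - y i) = (\<lambda>i. window_part m a x i - window_part m a y i)"
  unfolding window_part_def by auto

lemma window_part_scale: "window_part m a (\<lambda>i. c * x i) = (\<lambda>i. c * window_part m a x i)"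
  unfolding window_part_def by auto

lemma hbil_window_part:
  assumes "a \<le> m" "\<And>i. 2*m - a \<le> i \<Longrightarrow> x i = 0" "\<And>i. 2*m - a \<le> i \<Longrightarrow> y i = 0"
  shows "hbil m x y = hbil m (window_part m a x) (window_part m a y)"
  unfolding hbil_def
proof (rule sum.cong[OF refl])
  fix i assume "i \<in> {..<m}"
  then show "x i * y (2*m-1-i) + y i * x (2*m-1-i) =
      window_part m a x i * window_part m a y (2*m-1-i) + window_part m a y i * window_part m a x (2*m-1-i)"
    using assms by (cases "i < a") (auto simp: window_part_def)
qed

lemma hquad_window_part:
  assumes "a \<le> m" "\<And>i. 2*m - a \<le> i \<Longrightarrow> x i = 0"
  shows "hquad m x = hquad m (window_part m a x)"
  unfolding hquad_def
proof (rule sum.cong[OF refl])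
  fix i assume "i \<in> {..<m}"
  then show "x i * x (2*m-1-i) = window_part m a x i * window_part m a x (2*m-1-i)"
    using assms by (cases "i < a") (auto simp: window_part_def)
qed

section \<open>Upper triangular orthogonal maps\<close>

text \<open>U is upper triangular and preserves the hyperbolic form on k^2m. Its compression to the
  window [a, 2m - a) (apply U, then forget the coordinates outside the window) is again upper
  triangular and orthogonal; fix_space a and defect_space a are the kernel and the image of
  the compression minus the identity.\<close>

locale upper_orth =
  fixes U :: "nat \<Rightarrow> nat \<Rightarrow> 'k::field" and m :: nat
  assumes upper: "\<And>i j. j < i \<Longrightarrow> U i j = 0"
    and preserves_hquad: "\<And>x. x \<in> window m 0 \<Longrightarrow> hquad m (matvec m U x) = hquad m x"
begin

definition fix_space :: "nat \<Rightarrow> (nat \<Rightarrow> 'k) set" where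
  "fix_space a = {x \<in> window m a. window_part m a (matvec m U x) = x}"

definition defect_space :: "nat \<Rightarrow> (nat \<Rightarrow> 'k) set" where
  "defect_space a = {(\<lambda>i. window_part m a (matvec m U z) i - z i) | z. z \<in> window m a}"

definition fix_perp :: "nat \<Rightarrow> (nat \<Rightarrow> 'k) set" where
  "fix_perp a = {z \<in> window m a. \<forall>y \<in> fix_space a. hbil m y z = 0}"

lemma matvec_vanishes_above:
  assumes "x \<in> window m a" "2*m - a \<le> i"
  shows "matvec m U x i = 0"
  unfolding matvec_def
proof (intro sum.neutral ballI)
  fix j assume "j \<in> {..<2*m}"
  show "U i j * x j = 0"
  proof (cases "j < 2*m - a")
    case True then show ?thesis using assms(2) upper by simp
  qed (use assms(1) in \<open>simp add: window_def\<close>)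
qed

lemma matvec_in_window_0: "matvec m U x \<in> window m 0"
  unfolding window_def matvec_def by (auto intro!: sum.neutral simp: upper)

lemma preserves_hbil:
  assumes "x \<in> window m 0" "y \<in> window m 0"
  shows "hbil m (matvec m U x) (matvec m U y) = hbil m x y"
proof -
  have "hquad m (matvec m U (\<lambda>i. x i + y i)) = hquad m (\<lambda>i. x i + y i)"
    using assms by (intro preserves_hquad window_add)
  then show ?thesis using preserves_hquad[OF assms(1)] preserves_hquad[OF assms(2)]
    by (simp add: matvec_add hquad_add)
qed

lemma fix_space_add: "x \<in> fix_space a \<Longrightarrow> y \<in> fix_space a \<Longrightarrow> (\<lambda>i. x i + y i) \<in> fix_space a"
  unfolding fix_space_def by (auto simp: matvec_add window_part_add window_add)

lemma fix_space_diff: "x \<in> fix_space a \<Longrightarrow> y \<in> fix_space a \<Longrightarrow> (\<lambda>i. x i - y i) \<in> fix_space a"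
  unfolding fix_space_def by (auto simp: matvec_diff window_part_diff window_diff)

lemma fix_space_scale: "x \<in> fix_space a \<Longrightarrow> (\<lambda>i. c * x i) \<in> fix_space a"
  unfolding fix_space_def by (auto simp: matvec_scale window_part_scale window_scale)

lemma fix_space_middle: "fix_space m = {\<lambda>i. 0}"
  unfolding fix_space_def window_middle by (auto simp: window_part_def)

lemma fix_perp_middle: "fix_perp m \<subseteq> defect_space m"
  unfolding fix_perp_def defect_space_def window_middle by (auto simp: window_part_def)

end

text \<open>Peeling off the hyperbolic plane spanned by the coordinates a and opp = 2m-1-a: a vector
  of the window at level a is join \<alpha> y \<beta> = \<alpha> e_a + y + \<beta> e_opp with y in the window at
  level a + 1, and in these coordinates the compression is the block matrix
  [[diag_a, top_coord, corner], [0, inner, mid_col], [0, 0, diag_opp]] (compress_join).\<close>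

locale upper_orth_step = upper_orth U m for U :: "nat \<Rightarrow> nat \<Rightarrow> 'k::field" and m +
  fixes a :: nat
  assumes a_less: "a < m"
begin

definition "opp = 2*m - 1 - a"

lemma opp_bounds: "a < opp" "m \<le> opp" "opp < 2*m" "Suc a \<le> m"
  using a_less by (auto simp: opp_def)

lemma opp_sum: "opp + a + 1 = 2*m"
  using a_less by (auto simp: opp_def)

lemma opp_eq [simp]: "2*m - 1 - a = opp" "2*m - Suc a = opp" "2*m - a = Suc opp"
  using a_less by (auto simp: opp_def)

definition join :: "'k \<Rightarrow> (nat \<Rightarrow> 'k) \<Rightarrow> 'k \<Rightarrow> nat \<Rightarrow> 'k" where
  "join \<alpha> y \<beta> = (\<lambda>i. \<alpha> * unit_fun a i + y i + \<beta> * unit_fun opp i)"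

definition "diag_a = U a a"
definition "diag_opp = U opp opp"
definition "corner = U a opp"
definition "mid_col = window_part m (Suc a) (\<lambda>i. U i opp)"
definition "top_coord y = matvec m U y a"
definition "inner y = window_part m (Suc a) (matvec m U y)"

lemma window_Suc_ends: "y \<in> window m (Suc a) \<Longrightarrow> y a = 0 \<and> y opp = 0"
  using opp_bounds opp_sum unfolding window_def by auto

lemma window_Suc_subset: "y \<in> window m (Suc a) \<Longrightarrow> y \<in> window m a"
  using window_antimono[of a "Suc a" m] by auto

lemma window_Suc_subset_0: "y \<in> window m (Suc a) \<Longrightarrow> y \<in> window m 0"
  using window_antimono[of 0 "Suc a" m] by auto

lemma join_in_window: "y \<in> window m (Suc a) \<Longrightarrow> join \<alpha> y \<beta> \<in> window m a"
  using opp_bounds opp_sum unfolding window_def join_def unit_fun_def by auto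

lemma join_a: "y \<in> window m (Suc a) \<Longrightarrow> join \<alpha> y \<beta> a = \<alpha>"
  using opp_bounds window_Suc_ends unfolding join_def unit_fun_def by auto

lemma join_opp: "y \<in> window m (Suc a) \<Longrightarrow> join \<alpha> y \<beta> opp = \<beta>"
  using opp_bounds window_Suc_ends unfolding join_def unit_fun_def by auto

lemma window_part_join: "y \<in> window m (Suc a) \<Longrightarrow> window_part m (Suc a) (join \<alpha> y \<beta>) = y"
  using opp_bounds opp_sum unfolding join_def unit_fun_def window_part_def window_def
  by (auto simp: fun_eq_iff)

lemma join_decomp: "x \<in> window m a \<Longrightarrow> join (x a) (window_part m (Suc a) x) (x opp) = x"
  using opp_bounds opp_sum unfolding join_def unit_fun_def window_part_def window_def
  by (auto simp: fun_eq_iff)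

lemma join_eq_iff:
  assumes "y \<in> window m (Suc a)" "y' \<in> window m (Suc a)"
  shows "join \<alpha> y \<beta> = join \<alpha>' y' \<beta>' \<longleftrightarrow> \<alpha> = \<alpha>' \<and> y = y' \<and> \<beta> = \<beta>'"
  by (metis assms join_a join_opp window_part_join)

lemma join_diff:
  "(\<lambda>i. join \<alpha> y \<beta> i - join \<alpha>' y' \<beta>' i) = join (\<alpha> - \<alpha>') (\<lambda>i. y i - y' i) (\<beta> - \<beta>')"
  by (auto simp: join_def fun_eq_iff algebra_simps)

lemma card_window_join:
  "card {x \<in> window m a. P x} = card {(\<alpha>, y, \<beta>). y \<in> window m (Suc a) \<and> P (join \<alpha> y \<beta>)}"
proof -
  have "bij_betw (\<lambda>(\<alpha>, y, \<beta>). join \<alpha> y \<beta>) {(\<alpha>, y, \<beta>). y \<in> window m (Suc a) \<and> P (join \<alpha> y \<beta>)}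
      {x \<in> window m a. P x}"
    by (rule bij_betw_byWitness[where f' = "\<lambda>x. (x a, window_part m (Suc a) x, x opp)"])
      (auto simp: join_a join_opp window_part_join join_decomp join_in_window window_part_in_window)
  then show ?thesis by (rule bij_betw_same_card[symmetric])
qed

lemma hbil_split:
  assumes "\<And>i. 2*m - a \<le> i \<Longrightarrow> x i = 0" "\<And>i. 2*m - a \<le> i \<Longrightarrow> y i = 0"
  shows "hbil m x y = x a * y opp + x opp * y a
    + hbil m (window_part m (Suc a) x) (window_part m (Suc a) y)"
proof -
  let ?x' = "window_part m (Suc a) x" and ?y' = "window_part m (Suc a) y"
  have "x i * y (2*m-1-i) + y i * x (2*m-1-i) = ?x' i * ?y' (2*m-1-i) + ?y' i * ?x' (2*m-1-i)
      + (if i = a then x a * y opp + x opp * y a else 0)" if "i < m" for i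
  proof -
    consider "i < a" | "i = a" | "a < i" by linarith
    then show ?thesis
    proof cases
      case 1
      then have "Suc opp \<le> 2*m-1-i" using that opp_sum by linarith
      then show ?thesis using 1 assms by (simp add: window_part_def)
    next
      case 2
      then have "2*m-1-i = opp" by simp
      then show ?thesis using 2 by (simp add: window_part_def mult.commute)
    qed (use that a_less opp_sum in \<open>auto simp: window_part_def\<close>)
  qed
  then have "hbil m x y = (\<Sum>i<m. ?x' i * ?y' (2*m-1-i) + ?y' i * ?x' (2*m-1-i)
      + (if i = a then x a * y opp + x opp * y a else 0))"
    unfolding hbil_def by (intro sum.cong) auto
  also have "\<dots> = hbil m ?x' ?y' + (x a * y opp + x opp * y a)"
    using a_less by (simp add: sum.distrib hbil_def)
  finally show ?thesis by simp
qed

lemma hquad_split: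
  assumes "\<And>i. 2*m - a \<le> i \<Longrightarrow> x i = 0"
  shows "hquad m x = x a * x opp + hquad m (window_part m (Suc a) x)"
proof -
  let ?x' = "window_part m (Suc a) x"
  have "x i * x (2*m-1-i) = ?x' i * ?x' (2*m-1-i) + (if i = a then x a * x opp else 0)"
    if "i < m" for i
  proof -
    consider "i < a" | "i = a" | "a < i" by linarith
    then show ?thesis
    proof cases
      case 1
      then have "Suc opp \<le> 2*m-1-i" using that opp_sum by linarith
      then show ?thesis using 1 assms by (simp add: window_part_def)
    next
      case 2
      then have "2*m-1-i = opp" by simp
      then show ?thesis using 2 by (simp add: window_part_def)
    qed (use that a_less opp_sum in \<open>auto simp: window_part_def\<close>)
  qed
  then have "hquad m x = (\<Sum>i<m. ?x' i * ?x' (2*m-1-i) + (if i = a then x a * x opp else 0))"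
    unfolding hquad_def by (intro sum.cong) auto
  also have "\<dots> = hquad m ?x' + x a * x opp"
    using a_less by (simp add: sum.distrib hquad_def)
  finally show ?thesis by simp
qed

lemma hbil_join:
  assumes "y \<in> window m (Suc a)" "y' \<in> window m (Suc a)"
  shows "hbil m (join \<alpha> y \<beta>) (join \<alpha>' y' \<beta>') = \<alpha> * \<beta>' + \<beta> * \<alpha>' + hbil m y y'"
proof -
  have "join \<gamma> z \<delta> i = 0" if "z \<in> window m (Suc a)" "2*m - a \<le> i" for \<gamma> z \<delta> i
    using join_in_window[OF that(1)] that(2) unfolding window_def by blast
  then show ?thesis
    using hbil_split[of "join \<alpha> y \<beta>" "join \<alpha>' y' \<beta>'"] assms
    by (simp add: join_a join_opp window_part_join)
qed

lemma hbil_join_left: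
  assumes "z \<in> window m a" "y \<in> window m (Suc a)"
  shows "hbil m (join \<alpha> y \<beta>) z = \<alpha> * z opp + \<beta> * z a + hbil m y (window_part m (Suc a) z)"
  using hbil_join[OF assms(2) window_part_in_window] join_decomp[OF assms(1)] by metis

lemma inner_in_window: "inner y \<in> window m (Suc a)"
  unfolding inner_def by (rule window_part_in_window)

lemma mid_col_in_window: "mid_col \<in> window m (Suc a)"
  unfolding mid_col_def by (rule window_part_in_window)

lemma inner_add: "inner (\<lambda>i. x i + y i) = (\<lambda>i. inner x i + inner y i)"
  unfolding inner_def by (simp add: matvec_add window_part_add)

lemma inner_diff: "inner (\<lambda>i. x i - y i) = (\<lambda>i. inner x i - inner y i)"
  unfolding inner_def by (simp add: matvec_diff window_part_diff)

lemma inner_scale: "inner (\<lambda>i. c * x i) = (\<lambda>i. c * inner x i)"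
  unfolding inner_def by (simp add: matvec_scale window_part_scale)

lemma inner_uminus: "inner (\<lambda>i. - x i) = (\<lambda>i. - inner x i)"
  using inner_scale[of "-1" x] by simp

lemma inner_zero: "inner (\<lambda>i. 0) = (\<lambda>i. 0)"
  unfolding inner_def by (simp add: window_part_def)

lemma top_coord_add: "top_coord (\<lambda>i. x i + y i) = top_coord x + top_coord y"
  unfolding top_coord_def by (simp add: matvec_add)

lemma top_coord_diff: "top_coord (\<lambda>i. x i - y i) = top_coord x - top_coord y"
  unfolding top_coord_def by (simp add: matvec_diff)

lemma top_coord_scale: "top_coord (\<lambda>i. c * x i) = c * top_coord x"
  unfolding top_coord_def by (simp add: matvec_scale)

lemma top_coord_uminus: "top_coord (\<lambda>i. - x i) = - top_coord x"
  using top_coord_scale[of "-1" x] by simp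

lemma top_coord_zero: "top_coord (\<lambda>i. 0) = 0"
  unfolding top_coord_def by simp

lemma compress_join:
  assumes y: "y \<in> window m (Suc a)"
  shows "window_part m a (matvec m U (join \<alpha> y \<beta>)) =
    join (\<alpha> * diag_a + top_coord y + \<beta> * corner) (\<lambda>i. inner y i + \<beta> * mid_col i) (\<beta> * diag_opp)"
proof
  fix i
  have Ux: "matvec m U (join \<alpha> y \<beta>) = (\<lambda>i. \<alpha> * U i a + matvec m U y i + \<beta> * U i opp)"
    using opp_bounds unfolding join_def by (simp add: matvec_add matvec_scale matvec_unit_fun)
  have "matvec m U y opp = 0" using matvec_vanishes_above[OF y] opp_bounds by simp
  moreover have "U opp a = 0" using upper opp_bounds by simp
  ultimately consider "i < a" | "i = a" | "a < i \<and> i < opp" | "i = opp" | "opp < i" by linarith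
  then show "window_part m a (matvec m U (join \<alpha> y \<beta>)) i =
    join (\<alpha> * diag_a + top_coord y + \<beta> * corner) (\<lambda>i. inner y i + \<beta> * mid_col i) (\<beta> * diag_opp) i"
    unfolding Ux using opp_bounds opp_sum \<open>matvec m U y opp = 0\<close> \<open>U opp a = 0\<close>
    by cases (auto simp: window_part_def join_def unit_fun_def inner_def mid_col_def
      diag_a_def diag_opp_def corner_def top_coord_def upper)
qed

lemma fix_space_join:
  assumes y: "y \<in> window m (Suc a)"
  shows "join \<alpha> y \<beta> \<in> fix_space a \<longleftrightarrow>
    \<alpha> * diag_a + top_coord y + \<beta> * corner = \<alpha> \<and> (\<lambda>i. inner y i + \<beta> * mid_col i) = y \<and>
    \<beta> * diag_opp = \<beta>"
proof -
  have "(\<lambda>i. inner y i + \<beta> * mid_col i) \<in> window m (Suc a)"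
    by (intro window_add window_scale inner_in_window mid_col_in_window)
  then show ?thesis
    unfolding fix_space_def using join_in_window[OF y] compress_join[OF y] join_eq_iff[OF _ y] by auto
qed

lemma fix_space_Suc: "y \<in> fix_space (Suc a) \<longleftrightarrow> y \<in> window m (Suc a) \<and> inner y = y"
  unfolding fix_space_def inner_def by auto

lemma defect_space_Suc:
  "z \<in> defect_space (Suc a) \<longleftrightarrow> (\<exists>y \<in> window m (Suc a). z = (\<lambda>i. inner y i - y i))"
  unfolding defect_space_def inner_def by auto

lemma defect_space_join:
  assumes z: "z \<in> window m a" and y: "y \<in> window m (Suc a)"
    and "\<alpha> * diag_a + top_coord y + \<beta> * corner - \<alpha> = z a"
    and "(\<lambda>i. inner y i + \<beta> * mid_col i - y i) = window_part m (Suc a) z"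
    and "\<beta> * diag_opp - \<beta> = z opp"
  shows "z \<in> defect_space a"
proof -
  have "(\<lambda>i. window_part m a (matvec m U (join \<alpha> y \<beta>)) i - join \<alpha> y \<beta> i) = z"
    unfolding compress_join[OF y] join_diff using assms by (simp add: join_decomp)
  then show ?thesis unfolding defect_space_def using join_in_window[OF y] by force
qed

lemma window_part_unit_fun_ends:
  "window_part m (Suc a) (unit_fun a) = (\<lambda>i. 0)" "window_part m (Suc a) (unit_fun opp) = (\<lambda>i. 0)"
  by (auto simp: window_part_def unit_fun_def)

lemma diag_a_diag_opp: "diag_a * diag_opp = 1"
proof -
  have "hbil m (\<lambda>i. U i a) (\<lambda>i. U i opp) = hbil m (unit_fun a) (unit_fun opp)"
    using preserves_hbil[OF unit_fun_window_0 unit_fun_window_0, of a opp] opp_bounds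
    by (simp add: matvec_unit_fun)
  moreover have "window_part m (Suc a) (\<lambda>i. U i a) = (\<lambda>i. 0)"
    by (auto simp: window_part_def upper)
  then have "hbil m (\<lambda>i. U i a) (\<lambda>i. U i opp) = diag_a * diag_opp"
    using hbil_split[of "\<lambda>i. U i a" "\<lambda>i. U i opp"] opp_bounds opp_sum
    by (simp add: upper diag_a_def diag_opp_def)
  moreover have "hbil m (unit_fun a) (unit_fun opp) = (1::'k)"
    using hbil_split[of "unit_fun a" "unit_fun opp"] opp_bounds
    by (simp add: window_part_unit_fun_ends) (simp add: unit_fun_def)
  ultimately show ?thesis by simp
qed

lemma diag_opp_eq_1_iff: "diag_opp = 1 \<longleftrightarrow> diag_a = 1"
  using diag_a_diag_opp by auto

lemma top_coord_mid_col:
  assumes y: "y \<in> window m (Suc a)"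
  shows "top_coord y * diag_opp + hbil m (inner y) mid_col = 0"
proof -
  have "hbil m (matvec m U y) (\<lambda>i. U i opp) = hbil m y (unit_fun opp)"
    using preserves_hbil[OF window_Suc_subset_0[OF y] unit_fun_window_0, of opp] opp_bounds
    by (simp add: matvec_unit_fun)
  moreover have "hbil m (matvec m U y) (\<lambda>i. U i opp) = top_coord y * diag_opp + hbil m (inner y) mid_col"
    using hbil_split[of "matvec m U y" "\<lambda>i. U i opp"] matvec_vanishes_above[OF window_Suc_subset[OF y]]
      matvec_vanishes_above[OF y, of opp] opp_bounds
    by (simp add: upper top_coord_def diag_opp_def inner_def mid_col_def)
  moreover have "hbil m y (unit_fun opp) = 0"
    using hbil_split[of y "unit_fun opp"] window_Suc_subset[OF y] window_Suc_ends[OF y] opp_bounds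
    by (simp add: window_part_unit_fun_ends window_def) (simp add: unit_fun_def)
  ultimately show ?thesis by simp
qed

lemma corner_mid_col: "corner * diag_opp + hquad m mid_col = 0"
proof -
  have "hquad m (\<lambda>i. U i opp) = hquad m (unit_fun opp)"
    using preserves_hquad[OF unit_fun_window_0, of opp] opp_bounds
    by (simp add: matvec_unit_fun)
  moreover have "hquad m (\<lambda>i. U i opp) = corner * diag_opp + hquad m mid_col"
    using hquad_split[of "\<lambda>i. U i opp"] opp_bounds by (simp add: upper corner_def diag_opp_def mid_col_def)
  moreover have "hquad m (unit_fun opp :: nat \<Rightarrow> 'k) = 0"
    using hquad_split[of "unit_fun opp"] opp_bounds
    by (simp add: window_part_unit_fun_ends) (simp add: unit_fun_def)
  ultimately show ?thesis by simp
qed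

lemma inner_hbil:
  assumes "y \<in> window m (Suc a)" "z \<in> window m (Suc a)"
  shows "hbil m (inner y) (inner z) = hbil m y z"
  using preserves_hbil[OF window_Suc_subset_0 window_Suc_subset_0, OF assms]
    hbil_window_part[of "Suc a" m "matvec m U y" "matvec m U z"] opp_bounds
    matvec_vanishes_above[OF assms(1)] matvec_vanishes_above[OF assms(2)]
  by (simp add: inner_def)

lemma inner_hquad:
  assumes "y \<in> window m (Suc a)"
  shows "hquad m (inner y) = hquad m y"
  using preserves_hquad[OF window_Suc_subset_0, OF assms]
    hquad_window_part[of "Suc a" m "matvec m U y"] opp_bounds matvec_vanishes_above[OF assms]
  by (simp add: inner_def)

text \<open>When mid_col = inner z - z lies in the defect space of the inner block, the first
  coordinate of U is controlled by z.\<close>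

lemma top_coord_fix_space_hit:
  assumes y: "y \<in> fix_space (Suc a)" and z: "z \<in> window m (Suc a)"
    and zc: "(\<lambda>i. inner z i - z i) = mid_col"
  shows "top_coord y = 0"
proof -
  have ym: "y \<in> window m (Suc a)" and uy: "inner y = y" using y fix_space_Suc by auto
  have "hbil m y mid_col = hbil m y (inner z) - hbil m y z"
    unfolding zc[symmetric] by (rule hbil_diff_right)
  also have "hbil m y z = hbil m y (inner z)" using inner_hbil[OF ym z] uy by simp
  finally have "top_coord y * diag_opp = 0" using top_coord_mid_col[OF ym] uy by simp
  then show ?thesis using diag_a_diag_opp by auto
qed

lemma corner_hit:
  assumes z: "z \<in> window m (Suc a)" and zc: "(\<lambda>i. inner z i - z i) = mid_col"
  shows "corner = top_coord z"
proof -
  have "hquad m mid_col = hquad m (inner z) + hquad m z - hbil m (inner z) z"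
    unfolding zc[symmetric] by (rule hquad_diff)
  moreover have "hbil m (inner z) mid_col = 2 * hquad m (inner z) - hbil m (inner z) z"
    unfolding zc[symmetric] hbil_diff_right hbil_self ..
  ultimately have "hquad m mid_col = hbil m (inner z) mid_col"
    unfolding inner_hquad[OF z] by (simp only: mult_2)
  then have "corner * diag_opp = top_coord z * diag_opp"
    using corner_mid_col top_coord_mid_col[OF z] by (metis add_right_cancel)
  then show ?thesis using diag_a_diag_opp by (metis mult_cancel_right zero_neq_one mult_zero_right)
qed

definition pair_fix :: "((nat \<Rightarrow> 'k) \<times> 'k) set" where
  "pair_fix = {(y, d). y \<in> window m (Suc a) \<and> (\<lambda>i. inner y i + d * mid_col i) = y \<and>
      top_coord y + d * corner = 0}"

lemma card_pair_fix_hit: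
  assumes z: "z \<in> window m (Suc a)" and zc: "(\<lambda>i. inner z i - z i) = mid_col"
  shows "card pair_fix = CARD('k) * card (fix_space (Suc a))"
proof -
  have shift: "((\<lambda>i. y i - d * z i), d) \<in> pair_fix" if y: "y \<in> fix_space (Suc a)" for y d
  proof -
    have ym: "y \<in> window m (Suc a)" and uy: "inner y = y" using y fix_space_Suc by auto
    have "(\<lambda>i. inner (\<lambda>i. y i - d * z i) i + d * mid_col i) = (\<lambda>i. y i - d * z i)"
      unfolding zc[symmetric] inner_diff inner_scale uy by (simp add: algebra_simps)
    moreover have "top_coord (\<lambda>i. y i - d * z i) + d * corner = 0"
      using top_coord_fix_space_hit[OF y z zc] corner_hit[OF z zc]
      by (simp add: top_coord_diff top_coord_scale)
    ultimately show ?thesis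
      unfolding pair_fix_def using ym z by (auto intro: window_diff window_scale)
  qed
  have unshift: "(\<lambda>i. y i + d * z i) \<in> fix_space (Suc a)" if "(y, d) \<in> pair_fix" for y d
  proof -
    from that have ym: "y \<in> window m (Suc a)" and e: "(\<lambda>i. inner y i + d * mid_col i) = y"
      unfolding pair_fix_def by auto
    have "inner y i + d * inner z i = y i + d * z i" for i
    proof -
      have "inner y i + d * mid_col i = y i" using fun_cong[OF e, of i] by simp
      moreover have "mid_col i = inner z i - z i" using fun_cong[OF zc, of i] by simp
      ultimately show ?thesis by (simp add: algebra_simps)
    qed
    then have "inner (\<lambda>i. y i + d * z i) = (\<lambda>i. y i + d * z i)"
      unfolding inner_add inner_scale by (rule ext)
    moreover have "(\<lambda>i. y i + d * z i) \<in> window m (Suc a)"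
      using ym z by (intro window_add window_scale)
    ultimately show ?thesis unfolding fix_space_Suc by blast
  qed
  have "bij_betw (\<lambda>(d, y). ((\<lambda>i. y i - d * z i), d)) (UNIV \<times> fix_space (Suc a)) pair_fix"
    by (rule bij_betw_byWitness[where f' = "\<lambda>(y, d). (d, (\<lambda>i. y i + d * z i))"])
      (use shift unshift in auto)
  then have "card ((UNIV :: 'k set) \<times> fix_space (Suc a)) = card pair_fix"
    by (rule bij_betw_same_card)
  then show ?thesis by (simp add: card_cartesian_product)
qed

lemma exists_fix_space_top_coord_nonzero:
  assumes IH: "fix_perp (Suc a) \<subseteq> defect_space (Suc a)"
    and miss: "mid_col \<notin> defect_space (Suc a)"
  obtains y1 where "y1 \<in> fix_space (Suc a)" "top_coord y1 \<noteq> 0"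
proof -
  obtain y1 where y1: "y1 \<in> fix_space (Suc a)" and b1: "hbil m y1 mid_col \<noteq> 0"
    using IH miss mid_col_in_window unfolding fix_perp_def by blast
  then have "top_coord y1 * diag_opp + hbil m y1 mid_col = 0"
    using top_coord_mid_col fix_space_Suc by fastforce
  then show ?thesis using that y1 b1 by fastforce
qed

lemma card_fix_space_top_coord_kernel:
  assumes y1: "y1 \<in> fix_space (Suc a)" and r1: "top_coord y1 \<noteq> 0"
  shows "card (fix_space (Suc a)) = CARD('k) * card {y \<in> fix_space (Suc a). top_coord y = 0}"
proof -
  let ?K0 = "{y \<in> fix_space (Suc a). top_coord y = 0}"
  let ?split = "\<lambda>y. (top_coord y / top_coord y1, \<lambda>i. y i - top_coord y / top_coord y1 * y1 i)"
  have into: "(\<lambda>i. y i + l * y1 i) \<in> fix_space (Suc a)" if "y \<in> ?K0" for l y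
    using that y1 by (auto intro!: fix_space_add fix_space_scale)
  have split: "?split y \<in> UNIV \<times> ?K0" if y: "y \<in> fix_space (Suc a)" for y
  proof -
    have "top_coord (\<lambda>i. y i - top_coord y / top_coord y1 * y1 i) = 0"
      using r1 by (simp only: top_coord_diff top_coord_scale) simp
    moreover have "(\<lambda>i. y i - top_coord y / top_coord y1 * y1 i) \<in> fix_space (Suc a)"
      using y y1 by (intro fix_space_diff fix_space_scale)
    ultimately show ?thesis by simp
  qed
  have split_into: "?split (\<lambda>i. y i + l * y1 i) = (l, y)" if "y \<in> ?K0" for l y
  proof -
    have "top_coord (\<lambda>i. y i + l * y1 i) = l * top_coord y1"
      using that by (simp add: top_coord_add top_coord_scale)
    then show ?thesis using r1 by simp
  qed
  have "bij_betw (\<lambda>(l, y). (\<lambda>i. y i + l * y1 i)) (UNIV \<times> ?K0) (fix_space (Suc a))"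
    by (rule bij_betw_byWitness[where f' = ?split]) (use into split split_into in auto)
  then have "card ((UNIV :: 'k set) \<times> ?K0) = card (fix_space (Suc a))" by (rule bij_betw_same_card)
  then show ?thesis by (simp add: card_cartesian_product)
qed

lemma pair_fix_miss:
  assumes miss: "mid_col \<notin> defect_space (Suc a)"
  shows "pair_fix = (\<lambda>y. (y, 0)) ` {y \<in> fix_space (Suc a). top_coord y = 0}"
proof -
  have "d = 0" if "(y, d) \<in> pair_fix" for y d
  proof (rule ccontr)
    assume d: "d \<noteq> 0"
    from that have y: "y \<in> window m (Suc a)" and e: "\<And>i. inner y i + d * mid_col i = y i"
      unfolding pair_fix_def by (auto dest: fun_cong)
    have "(\<lambda>i. inner (\<lambda>i. (- 1 / d) * y i) i - (- 1 / d) * y i) = mid_col"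
    proof
      fix i
      show "inner (\<lambda>i. (- 1 / d) * y i) i - (- 1 / d) * y i = mid_col i"
        unfolding inner_scale using e[of i] d by (simp add: field_simps)
    qed
    then show False using miss y defect_space_Suc window_scale by metis
  qed
  then show ?thesis by (force simp: pair_fix_def fix_space_Suc)
qed

lemma card_pair_fix_miss:
  assumes IH: "fix_perp (Suc a) \<subseteq> defect_space (Suc a)"
    and miss: "mid_col \<notin> defect_space (Suc a)"
  shows "CARD('k) * card pair_fix = card (fix_space (Suc a))"
proof -
  obtain y1 where "y1 \<in> fix_space (Suc a)" "top_coord y1 \<noteq> 0"
    using exists_fix_space_top_coord_nonzero[OF IH miss] .
  then show ?thesis
    using card_fix_space_top_coord_kernel pair_fix_miss[OF miss] by (simp add: card_image inj_on_def)
qed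

lemma odd_card_pair_fix:
  assumes fin: "finite (UNIV :: 'k set)"
    and even: "card (fix_space (Suc a)) = CARD('k) ^ (2*e)"
    and IH: "fix_perp (Suc a) \<subseteq> defect_space (Suc a)"
  shows "\<exists>e'. card pair_fix = CARD('k) ^ (2*e' + 1)"
proof (cases "mid_col \<in> defect_space (Suc a)")
  case True
  then obtain z where "z \<in> window m (Suc a)" "(\<lambda>i. inner z i - z i) = mid_col"
    using defect_space_Suc by metis
  then have "card pair_fix = CARD('k) ^ (2*e + 1)"
    using card_pair_fix_hit even by simp
  then show ?thesis ..
next
  case False
  then have h: "CARD('k) * card pair_fix = CARD('k) ^ (2*e)"
    using card_pair_fix_miss[OF IH] even by simp
  have "e \<noteq> 0"
  proof
    assume "e = 0"
    then have "CARD('k) * card pair_fix = 1" using h by simp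
    then show False using card_UNIV_field_ge_2[OF fin] by simp
  qed
  then obtain e' where "e = Suc e'" by (cases e) auto
  then have "CARD('k) * card pair_fix = CARD('k) * CARD('k) ^ (2*e' + 1)" using h by simp
  then have "card pair_fix = CARD('k) ^ (2*e' + 1)" using card_UNIV_field_ge_2[OF fin] by simp
  then show ?thesis ..
qed

lemma card_fix_space_generic:
  assumes t: "diag_a \<noteq> 1"
  shows "card (fix_space a) = card (fix_space (Suc a))"
proof -
  let ?lift = "\<lambda>y. (top_coord y / (1 - diag_a), y, 0 :: 'k)"
  have "{(\<alpha>, y, \<beta>). y \<in> window m (Suc a) \<and> join \<alpha> y \<beta> \<in> fix_space a} = ?lift ` fix_space (Suc a)"
  proof (intro equalityI subsetI)
    fix p assume "p \<in> {(\<alpha>, y, \<beta>). y \<in> window m (Suc a) \<and> join \<alpha> y \<beta> \<in> fix_space a}"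
    then obtain \<alpha> y \<beta> where p: "p = (\<alpha>, y, \<beta>)" and y: "y \<in> window m (Suc a)"
      and e: "\<alpha> * diag_a + top_coord y + \<beta> * corner = \<alpha>" "(\<lambda>i. inner y i + \<beta> * mid_col i) = y"
        "\<beta> * diag_opp = \<beta>"
      by (auto simp: fix_space_join)
    have "\<beta> * (diag_opp - 1) = 0" using e(3) by (simp add: algebra_simps)
    then have \<beta>: "\<beta> = 0" using t diag_opp_eq_1_iff by simp
    then have "\<alpha> = top_coord y / (1 - diag_a)" using e(1) t by (simp add: field_simps)
    then show "p \<in> ?lift ` fix_space (Suc a)" using p y e(2) \<beta> by (auto simp: fix_space_Suc)
  next
    fix p assume "p \<in> ?lift ` fix_space (Suc a)"
    then obtain y where p: "p = ?lift y" and y: "y \<in> window m (Suc a)" "inner y = y"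
      by (auto simp: fix_space_Suc)
    have "top_coord y / (1 - diag_a) * diag_a + top_coord y = top_coord y / (1 - diag_a)"
      using t by (simp add: field_simps)
    then show "p \<in> {(\<alpha>, y, \<beta>). y \<in> window m (Suc a) \<and> join \<alpha> y \<beta> \<in> fix_space a}"
      using p y by (simp add: fix_space_join)
  qed
  moreover have "card (fix_space a) = card {x \<in> window m a. x \<in> fix_space a}"
    by (rule arg_cong[where f = card]) (auto simp: fix_space_def)
  moreover have "inj_on ?lift (fix_space (Suc a))" by (auto simp: inj_on_def)
  ultimately show ?thesis using card_window_join[of "\<lambda>x. x \<in> fix_space a"] by (simp add: card_image)
qed

lemma card_fix_space_unipotent:
  assumes t: "diag_a = 1"
  shows "card (fix_space a) = CARD('k) * card pair_fix"
proof -
  have "card (fix_space a) = card {x \<in> window m a. x \<in> fix_space a}"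
    by (rule arg_cong[where f = card]) (auto simp: fix_space_def)
  also have "\<dots> = card {(\<alpha>, y, \<beta>). y \<in> window m (Suc a) \<and> join \<alpha> y \<beta> \<in> fix_space a}"
    by (rule card_window_join)
  also have "{(\<alpha>, y, \<beta>). y \<in> window m (Suc a) \<and> join \<alpha> y \<beta> \<in> fix_space a} = UNIV \<times> pair_fix"
    using t diag_opp_eq_1_iff by (auto simp: fix_space_join pair_fix_def add.assoc)
  finally show ?thesis by (simp add: card_cartesian_product)
qed

lemma even_card_fix_space_step:
  assumes fin: "finite (UNIV :: 'k set)"
    and even: "card (fix_space (Suc a)) = CARD('k) ^ (2*e)"
    and IH: "fix_perp (Suc a) \<subseteq> defect_space (Suc a)"
  shows "\<exists>e'. card (fix_space a) = CARD('k) ^ (2*e')"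
proof (cases "diag_a = 1")
  case True
  obtain e' where "card pair_fix = CARD('k) ^ (2*e' + 1)" using odd_card_pair_fix[OF fin even IH] by blast
  then have "card (fix_space a) = CARD('k) ^ (2 * Suc e')"
    using card_fix_space_unipotent[OF True] by simp
  then show ?thesis by blast
qed (use card_fix_space_generic even in auto)

lemma fix_perp_unipotent:
  assumes t: "diag_a = 1" and z: "z \<in> fix_perp a"
  shows "z opp = 0"
    and "\<And>y. y \<in> fix_space (Suc a) \<Longrightarrow> top_coord y = 0 \<Longrightarrow> hbil m y (window_part m (Suc a) z) = 0"
proof -
  have zw: "z \<in> window m a" and perp: "\<And>x. x \<in> fix_space a \<Longrightarrow> hbil m x z = 0"
    using z unfolding fix_perp_def by auto
  have "join 1 (\<lambda>i. 0) 0 \<in> fix_space a"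
    using t by (simp add: fix_space_join window_zero top_coord_zero inner_zero)
  then show "z opp = 0"
    using perp hbil_join_left[OF zw window_zero, of 1 0] by simp
  fix y assume "y \<in> fix_space (Suc a)" "top_coord y = 0"
  then have "y \<in> window m (Suc a)" "join 0 y 0 \<in> fix_space a"
    by (auto simp: fix_space_Suc fix_space_join)
  then show "hbil m y (window_part m (Suc a) z) = 0"
    using perp hbil_join_left[OF zw, of y 0 0] by simp
qed

lemma fix_perp_shift_generic:
  assumes t: "diag_a \<noteq> 1" and z: "z \<in> fix_perp a" and d: "d = z opp / (diag_opp - 1)"
  shows "(\<lambda>i. window_part m (Suc a) z i - d * mid_col i) \<in> fix_perp (Suc a)"
  unfolding fix_perp_def
proof (intro CollectI conjI ballI)
  let ?\<gamma> = "window_part m (Suc a) z"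
  have zw: "z \<in> window m a" and perp: "\<And>x. x \<in> fix_space a \<Longrightarrow> hbil m x z = 0"
    using z unfolding fix_perp_def by auto
  have t0: "diag_a \<noteq> 0" "diag_opp - 1 \<noteq> 0" "1 - diag_a \<noteq> 0"
    using diag_a_diag_opp t diag_opp_eq_1_iff by (auto simp del: diag_opp_eq_1_iff)
  have d': "d * diag_opp = z opp / (1 - diag_a)"
    using t0 diag_a_diag_opp unfolding d by (simp add: field_simps)
  show "(\<lambda>i. ?\<gamma> i - d * mid_col i) \<in> window m (Suc a)"
    by (intro window_diff window_scale window_part_in_window mid_col_in_window)
  fix y assume y: "y \<in> fix_space (Suc a)"
  then have yw: "y \<in> window m (Suc a)" and uy: "inner y = y" using fix_space_Suc by auto
  have "join (top_coord y / (1 - diag_a)) y 0 \<in> fix_space a"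
    using yw uy t0 by (simp add: fix_space_join field_simps)
  then have "hbil m (join (top_coord y / (1 - diag_a)) y 0) z = 0" by (rule perp)
  then have "top_coord y * z opp / (1 - diag_a) + hbil m y ?\<gamma> = 0"
    using hbil_join_left[OF zw yw, of "top_coord y / (1 - diag_a)" 0] by simp
  then have "hbil m y ?\<gamma> = - (top_coord y * z opp / (1 - diag_a))"
    by (simp add: eq_neg_iff_add_eq_0 add.commute)
  moreover have "hbil m y mid_col = - (top_coord y * diag_opp)"
    using top_coord_mid_col[OF yw] uy by (simp add: eq_neg_iff_add_eq_0 add.commute)
  ultimately have "hbil m y (\<lambda>i. ?\<gamma> i - d * mid_col i) = (d * diag_opp - z opp / (1 - diag_a)) * top_coord y"
    unfolding hbil_diff_right hbil_scale_right by (simp add: algebra_simps)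
  then show "hbil m y (\<lambda>i. ?\<gamma> i - d * mid_col i) = 0"
    using d' by simp
qed

lemma fix_perp_defect_generic:
  assumes t: "diag_a \<noteq> 1" and IH: "fix_perp (Suc a) \<subseteq> defect_space (Suc a)"
  shows "fix_perp a \<subseteq> defect_space a"
proof
  fix z assume z: "z \<in> fix_perp a"
  then have zw: "z \<in> window m a" unfolding fix_perp_def by auto
  define d where "d = z opp / (diag_opp - 1)"
  obtain y0 where y0: "y0 \<in> window m (Suc a)"
    and g: "(\<lambda>i. window_part m (Suc a) z i - d * mid_col i) = (\<lambda>i. inner y0 i - y0 i)"
    using IH fix_perp_shift_generic[OF t z d_def] defect_space_Suc by blast
  define \<alpha> where "\<alpha> = (z a - top_coord y0 - d * corner) / (diag_a - 1)"
  show "z \<in> defect_space a"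
  proof (rule defect_space_join[OF zw y0, of \<alpha> d])
    have "\<alpha> * (diag_a - 1) = z a - top_coord y0 - d * corner"
      using t unfolding \<alpha>_def by simp
    then show "\<alpha> * diag_a + top_coord y0 + d * corner - \<alpha> = z a"
      by (simp add: algebra_simps)
    show "(\<lambda>i. inner y0 i + d * mid_col i - y0 i) = window_part m (Suc a) z"
      using g by (auto simp: fun_eq_iff algebra_simps dest: fun_cong)
    have "diag_opp \<noteq> 1" using t diag_opp_eq_1_iff by simp
    then have "d * (diag_opp - 1) = z opp" unfolding d_def by simp
    then show "d * diag_opp - d = z opp" by (simp add: algebra_simps)
  qed
qed

lemma fix_perp_defect_hit:
  assumes t: "diag_a = 1" and IH: "fix_perp (Suc a) \<subseteq> defect_space (Suc a)"
    and z0: "z0 \<in> window m (Suc a)" and z0c: "(\<lambda>i. inner z0 i - z0 i) = mid_col"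
  shows "fix_perp a \<subseteq> defect_space a"
proof
  fix z assume z: "z \<in> fix_perp a"
  then have zw: "z \<in> window m a" and perp: "\<And>x. x \<in> fix_space a \<Longrightarrow> hbil m x z = 0"
    unfolding fix_perp_def by auto
  let ?\<gamma> = "window_part m (Suc a) z"
  have "?\<gamma> \<in> fix_perp (Suc a)"
    using fix_perp_unipotent(2)[OF t z] top_coord_fix_space_hit[OF _ z0 z0c]
    by (auto simp: fix_perp_def window_part_in_window)
  with IH obtain y0 where y0: "y0 \<in> window m (Suc a)" and g: "?\<gamma> = (\<lambda>i. inner y0 i - y0 i)"
    using defect_space_Suc by blast
  have "join 0 (\<lambda>i. - z0 i) 1 \<in> fix_space a"
    using t diag_opp_eq_1_iff corner_hit[OF z0 z0c] z0c[symmetric]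
    by (simp add: fix_space_join window_uminus[OF z0] top_coord_uminus inner_uminus)
  then have "hbil m (join 0 (\<lambda>i. - z0 i) 1) z = 0" by (rule perp)
  moreover have "hbil m (join 0 (\<lambda>i. - z0 i) 1) z = z a - hbil m z0 ?\<gamma>"
    using hbil_join_left[OF zw window_uminus[OF z0], of 0 1] by (simp add: hbil_uminus_left)
  ultimately have za: "z a = hbil m z0 ?\<gamma>" by simp
  have "top_coord y0 = - hbil m (inner y0) mid_col"
    using top_coord_mid_col[OF y0] t diag_opp_eq_1_iff by (simp add: eq_neg_iff_add_eq_0)
  also have "\<dots> = hbil m z0 ?\<gamma>"
    unfolding g z0c[symmetric] hbil_diff_right hbil_diff_left inner_hbil[OF y0 z0]
    by (simp add: hbil_commute)
  finally have "top_coord y0 = z a" using za by simp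
  then show "z \<in> defect_space a"
    using defect_space_join[OF zw y0, of 0 0] g fix_perp_unipotent(1)[OF t z] by simp
qed

lemma hbil_mid_col_unipotent:
  assumes t: "diag_a = 1" and y: "y \<in> fix_space (Suc a)"
  shows "hbil m y mid_col = - top_coord y"
proof -
  have yw: "y \<in> window m (Suc a)" and uy: "inner y = y" using y fix_space_Suc by auto
  have "top_coord y * diag_opp + hbil m (inner y) mid_col = 0" by (rule top_coord_mid_col[OF yw])
  then show ?thesis
    unfolding uy using t diag_opp_eq_1_iff by (simp add: eq_neg_iff_add_eq_0 add.commute)
qed

lemma fix_perp_shift_miss:
  assumes t: "diag_a = 1" and z: "z \<in> fix_perp a"
    and y1: "y1 \<in> fix_space (Suc a)" and r1: "top_coord y1 \<noteq> 0"
    and d: "d = - hbil m y1 (window_part m (Suc a) z) / top_coord y1"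
  shows "(\<lambda>i. window_part m (Suc a) z i - d * mid_col i) \<in> fix_perp (Suc a)"
  unfolding fix_perp_def
proof (intro CollectI conjI ballI)
  let ?\<gamma> = "window_part m (Suc a) z"
  show "(\<lambda>i. ?\<gamma> i - d * mid_col i) \<in> window m (Suc a)"
    by (intro window_diff window_scale window_part_in_window mid_col_in_window)
  fix y assume y: "y \<in> fix_space (Suc a)"
  let ?y' = "\<lambda>i. y i - top_coord y / top_coord y1 * y1 i"
  have "?y' \<in> fix_space (Suc a)" using y y1 by (intro fix_space_diff fix_space_scale)
  moreover have "top_coord ?y' = 0" using r1 by (simp only: top_coord_diff top_coord_scale) simp
  ultimately have "hbil m ?y' ?\<gamma> = 0" using fix_perp_unipotent(2)[OF t z] by blast
  then have "hbil m y ?\<gamma> = top_coord y / top_coord y1 * hbil m y1 ?\<gamma>"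
    by (simp only: hbil_diff_left hbil_scale_left) simp
  then show "hbil m y (\<lambda>i. ?\<gamma> i - d * mid_col i) = 0"
    using hbil_mid_col_unipotent[OF t y] r1 unfolding hbil_diff_right hbil_scale_right d by simp
qed

lemma fix_perp_defect_miss:
  assumes t: "diag_a = 1" and IH: "fix_perp (Suc a) \<subseteq> defect_space (Suc a)"
    and miss: "mid_col \<notin> defect_space (Suc a)"
  shows "fix_perp a \<subseteq> defect_space a"
proof
  fix z assume z: "z \<in> fix_perp a"
  then have zw: "z \<in> window m a" unfolding fix_perp_def by auto
  obtain y1 where y1: "y1 \<in> fix_space (Suc a)" and r1: "top_coord y1 \<noteq> 0"
    using exists_fix_space_top_coord_nonzero[OF IH miss] .
  define d where "d = - hbil m y1 (window_part m (Suc a) z) / top_coord y1"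
  obtain y0 where y0: "y0 \<in> window m (Suc a)"
    and g: "(\<lambda>i. window_part m (Suc a) z i - d * mid_col i) = (\<lambda>i. inner y0 i - y0 i)"
    using IH fix_perp_shift_miss[OF t z y1 r1 d_def] defect_space_Suc by blast
  define l where "l = (z a - d * corner - top_coord y0) / top_coord y1"
  have y1w: "y1 \<in> window m (Suc a)" and uy1: "inner y1 = y1" using y1 fix_space_Suc by auto
  show "z \<in> defect_space a"
  proof (rule defect_space_join[OF zw window_add[OF y0 window_scale[OF y1w, where c = l]], of 0 d])
    show "0 * diag_a + top_coord (\<lambda>i. y0 i + l * y1 i) + d * corner - 0 = z a"
      using r1 unfolding l_def by (simp only: top_coord_add top_coord_scale) simp
    show "(\<lambda>i. inner (\<lambda>i. y0 i + l * y1 i) i + d * mid_col i - (y0 i + l * y1 i)) = window_part m (Suc a) z"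
      using g uy1 by (auto simp: fun_eq_iff inner_add inner_scale algebra_simps dest: fun_cong)
    show "d * diag_opp - d = z opp"
      using fix_perp_unipotent(1)[OF t z] t diag_opp_eq_1_iff by simp
  qed
qed

lemma fix_perp_defect_step:
  assumes IH: "fix_perp (Suc a) \<subseteq> defect_space (Suc a)"
  shows "fix_perp a \<subseteq> defect_space a"
proof (cases "diag_a = 1")
  case True
  show ?thesis
  proof (cases "mid_col \<in> defect_space (Suc a)")
    case hit: True
    then obtain z0 where "z0 \<in> window m (Suc a)" "(\<lambda>i. inner z0 i - z0 i) = mid_col"
      using defect_space_Suc by metis
    then show ?thesis using fix_perp_defect_hit[OF True IH] by blast
  qed (use fix_perp_defect_miss[OF True IH] in blast)
qed (use fix_perp_defect_generic[OF _ IH] in blast)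

definition swap_outer :: "(nat \<Rightarrow> 'k) \<Rightarrow> nat \<Rightarrow> 'k" where
  "swap_outer x = x(a := x opp, opp := x a)"

lemma swap_outer_join:
  assumes "y \<in> window m (Suc a)"
  shows "swap_outer (join \<alpha> y \<beta>) = join \<beta> y \<alpha>"
  using opp_bounds window_Suc_ends[OF assms] unfolding swap_outer_def join_def unit_fun_def
  by (auto simp: fun_eq_iff)

lemma card_swap_fixed:
  "card {x \<in> window m a. window_part m a (matvec m U x) = swap_outer x} = card pair_fix"
proof -
  let ?P = "\<lambda>x. window_part m a (matvec m U x) = swap_outer x"
  have swap_fixed_join: "?P (join \<alpha> y \<beta>) \<longleftrightarrow>
      \<alpha> * diag_a + top_coord y + \<beta> * corner = \<beta> \<and> (\<lambda>i. inner y i + \<beta> * mid_col i) = y \<and>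
      \<beta> * diag_opp = \<alpha>" if y: "y \<in> window m (Suc a)" for \<alpha> \<beta> y
    unfolding compress_join[OF y] swap_outer_join[OF y]
    by (rule join_eq_iff[OF window_add[OF inner_in_window window_scale[OF mid_col_in_window]] y])
  have cancel: "\<beta> * diag_opp * diag_a = \<beta>" for \<beta>
    using diag_a_diag_opp by (simp add: mult.assoc mult.commute)
  have "{(\<alpha>, y, \<beta>). y \<in> window m (Suc a) \<and> ?P (join \<alpha> y \<beta>)}
      = (\<lambda>(y, \<beta>). (\<beta> * diag_opp, y, \<beta>)) ` pair_fix"
  proof (intro equalityI subsetI)
    fix p assume "p \<in> {(\<alpha>, y, \<beta>). y \<in> window m (Suc a) \<and> ?P (join \<alpha> y \<beta>)}"
    then obtain \<alpha> y \<beta> where p: "p = (\<alpha>, y, \<beta>)" and y: "y \<in> window m (Suc a)"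
      and e: "\<alpha> * diag_a + top_coord y + \<beta> * corner = \<beta>" "(\<lambda>i. inner y i + \<beta> * mid_col i) = y"
        "\<beta> * diag_opp = \<alpha>"
      using swap_fixed_join by blast
    have "top_coord y + \<beta> * corner = 0"
      using e(1) cancel[of \<beta>] unfolding e(3)[symmetric] by (simp add: add.assoc)
    then show "p \<in> (\<lambda>(y, \<beta>). (\<beta> * diag_opp, y, \<beta>)) ` pair_fix"
      using p y e(2,3) by (force simp: pair_fix_def)
  next
    fix p assume "p \<in> (\<lambda>(y, \<beta>). (\<beta> * diag_opp, y, \<beta>)) ` pair_fix"
    then obtain y \<beta> where p: "p = (\<beta> * diag_opp, y, \<beta>)" and y: "y \<in> window m (Suc a)"
      and e: "(\<lambda>i. inner y i + \<beta> * mid_col i) = y" "top_coord y + \<beta> * corner = 0"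
      by (auto simp: pair_fix_def)
    then show "p \<in> {(\<alpha>, y, \<beta>). y \<in> window m (Suc a) \<and> ?P (join \<alpha> y \<beta>)}"
      using swap_fixed_join[OF y] cancel[of \<beta>] by (simp add: add.assoc)
  qed
  moreover have "inj_on (\<lambda>(y, \<beta>). (\<beta> * diag_opp, y, \<beta>)) pair_fix" by (auto simp: inj_on_def)
  ultimately show ?thesis using card_window_join[of ?P] by (simp add: card_image)
qed

end

context upper_orth
begin

lemma fix_space_levels:
  assumes "finite (UNIV :: 'k set)"
  shows "a \<le> m \<Longrightarrow> (\<exists>e. card (fix_space a) = CARD('k) ^ (2*e)) \<and> fix_perp a \<subseteq> defect_space a"
proof (induction "m - a" arbitrary: a)
  case 0
  then have "a = m" by simp
  then show ?case using fix_space_middle fix_perp_middle by (intro conjI exI[of _ 0]) simp_all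
next
  case (Suc k)
  then interpret upper_orth_step U m a by unfold_locales simp
  have "k = m - Suc a" using Suc.hyps(2) by arith
  then obtain e where "card (fix_space (Suc a)) = CARD('k) ^ (2*e)"
    and IH: "fix_perp (Suc a) \<subseteq> defect_space (Suc a)"
    using Suc.hyps(1) a_less by fastforce
  then show ?case
    using even_card_fix_space_step[OF assms] fix_perp_defect_step by blast
qed

lemma odd_card_swap_fixed:
  assumes fin: "finite (UNIV :: 'k set)" and m: "0 < m"
  shows "\<exists>e. card {x \<in> window m 0. matvec m U x = x(0 := x (2*m-1), 2*m-1 := x 0)}
    = CARD('k) ^ (2*e + 1)"
proof -
  interpret upper_orth_step U m 0 by unfold_locales (rule m)
  have "opp = 2*m-1" by (simp del: opp_eq add: opp_def)
  moreover have "window_part m 0 (matvec m U x) = matvec m U x" for x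
    by (rule window_part_id[OF matvec_in_window_0])
  ultimately have "card {x \<in> window m 0. matvec m U x = x(0 := x (2*m-1), 2*m-1 := x 0)}
      = card pair_fix"
    using card_swap_fixed by (simp add: swap_outer_def)
  moreover obtain e where "card (fix_space 1) = CARD('k) ^ (2*e)" "fix_perp 1 \<subseteq> defect_space 1"
    using fix_space_levels[OF fin, of 1] m by auto
  ultimately show ?thesis using odd_card_pair_fix[OF fin] by simp
qed

end

section \<open>Counting over finite fields\<close>

lemma card_carrier_vec_finite:
  assumes "finite (UNIV :: 'k set)"
  shows "card (carrier_vec N :: 'k vec set) = CARD('k) ^ N"
proof -
  have "carrier_vec N = vec N ` ({..<N} \<rightarrow>\<^sub>E (UNIV :: 'k set))"
  proof
    show "carrier_vec N \<subseteq> vec N ` ({..<N} \<rightarrow>\<^sub>E (UNIV :: 'k set))"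
    proof
      fix x :: "'k vec" assume "x \<in> carrier_vec N"
      then have "x = vec N (restrict (($) x) {..<N})" by (auto intro!: eq_vecI)
      moreover have "restrict (($) x) {..<N} \<in> {..<N} \<rightarrow>\<^sub>E (UNIV :: 'k set)" by auto
      ultimately show "x \<in> vec N ` ({..<N} \<rightarrow>\<^sub>E (UNIV :: 'k set))" by blast
    qed
    show "vec N ` ({..<N} \<rightarrow>\<^sub>E (UNIV :: 'k set)) \<subseteq> carrier_vec N"
      by (rule image_subsetI) (rule vec_carrier)
  qed
  moreover have "inj_on (vec N) ({..<N} \<rightarrow>\<^sub>E (UNIV :: 'k set))"
  proof (rule inj_onI)
    fix f g :: "nat \<Rightarrow> 'k" assume "f \<in> {..<N} \<rightarrow>\<^sub>E UNIV" "g \<in> {..<N} \<rightarrow>\<^sub>E UNIV" "vec N f = vec N g"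
    then show "f = g" by (metis PiE_ext index_vec lessThan_iff)
  qed
  ultimately show ?thesis using assms by (simp add: card_image card_PiE)
qed

lemma card_carrier_vec_image_kernel:
  assumes A: "(A :: 'k::field mat) \<in> carrier_mat m N"
  shows "card (carrier_vec N :: 'k vec set) =
    card ((*\<^sub>v) A ` carrier_vec N) * card {x \<in> carrier_vec N. A *\<^sub>v x = 0\<^sub>v m}"
proof -
  let ?I = "(*\<^sub>v) A ` carrier_vec N" and ?K = "{x \<in> carrier_vec N. A *\<^sub>v x = 0\<^sub>v m}"
  define s where "s y = (SOME x. x \<in> carrier_vec N \<and> A *\<^sub>v x = y)" for y
  have s: "s y \<in> carrier_vec N" "A *\<^sub>v s y = y" if "y \<in> ?I" for y
    using someI_ex[of "\<lambda>x. x \<in> carrier_vec N \<and> A *\<^sub>v x = y"] that unfolding s_def by blast+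
  have "bij_betw (\<lambda>x. (A *\<^sub>v x, x - s (A *\<^sub>v x))) (carrier_vec N) (?I \<times> ?K)"
  proof (rule bij_betw_byWitness[where f' = "\<lambda>(y, k). s y + k"])
    show "\<forall>x\<in>carrier_vec N. (\<lambda>(y, k). s y + k) (A *\<^sub>v x, x - s (A *\<^sub>v x)) = x"
    proof
      fix x :: "'k vec" assume x: "x \<in> carrier_vec N"
      then have "s (A *\<^sub>v x) \<in> carrier_vec N" using s by blast
      then show "(\<lambda>(y, k). s y + k) (A *\<^sub>v x, x - s (A *\<^sub>v x)) = x" using x by (auto intro!: eq_vecI)
    qed
    show "\<forall>p\<in>?I \<times> ?K. (\<lambda>x. (A *\<^sub>v x, x - s (A *\<^sub>v x))) ((\<lambda>(y, k). s y + k) p) = p"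
    proof
      fix p assume "p \<in> ?I \<times> ?K"
      then obtain x k where p: "p = (A *\<^sub>v x, k)" and x: "x \<in> carrier_vec N"
        and k: "k \<in> carrier_vec N" "A *\<^sub>v k = 0\<^sub>v m"
        by blast
      have "A *\<^sub>v (s (A *\<^sub>v x) + k) = A *\<^sub>v x"
        using A s[of "A *\<^sub>v x"] x k by (simp add: mult_add_distrib_mat_vec)
      moreover have "s (A *\<^sub>v x) + k - s (A *\<^sub>v x) = k"
        using s[of "A *\<^sub>v x"] x k by (auto intro!: eq_vecI)
      ultimately show "(\<lambda>x. (A *\<^sub>v x, x - s (A *\<^sub>v x))) ((\<lambda>(y, k). s y + k) p) = p"
        unfolding p by simp
    qed
    show "(\<lambda>x. (A *\<^sub>v x, x - s (A *\<^sub>v x))) ` carrier_vec N \<subseteq> ?I \<times> ?K"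
    proof (rule image_subsetI)
      fix x :: "'k vec" assume x: "x \<in> carrier_vec N"
      have "A *\<^sub>v (x - s (A *\<^sub>v x)) = A *\<^sub>v x - A *\<^sub>v s (A *\<^sub>v x)"
        using A x s[of "A *\<^sub>v x"] by (simp add: mult_minus_distrib_mat_vec)
      then show "(A *\<^sub>v x, x - s (A *\<^sub>v x)) \<in> ?I \<times> ?K" using A x s[of "A *\<^sub>v x"] by auto
    qed
  qed (use s in auto)
  then show ?thesis by (simp add: bij_betw_same_card card_cartesian_product)
qed

context vec_space
begin

lemma card_span_lin_indpt:
  assumes fin: "finite (UNIV :: 'a set)" and S: "finite S" "S \<subseteq> carrier_vec n" and li: "lin_indpt S"
  shows "card (span S) = CARD('a) ^ card S"
proof -
  have "span S = (\<lambda>c. lincomb c S) ` (S \<rightarrow>\<^sub>E UNIV)"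
  proof
    show "span S \<subseteq> (\<lambda>c. lincomb c S) ` (S \<rightarrow>\<^sub>E UNIV)"
    proof
      fix u assume "u \<in> span S"
      then obtain c where "u = lincomb c S" using finite_span[OF S] by auto
      moreover have "lincomb c S = lincomb (restrict c S) S" using S by (intro lincomb_cong) auto
      ultimately show "u \<in> (\<lambda>c. lincomb c S) ` (S \<rightarrow>\<^sub>E UNIV)" by auto
    qed
  qed (use finite_span[OF S] in auto)
  moreover have "inj_on (\<lambda>c. lincomb c S) (S \<rightarrow>\<^sub>E UNIV)"
  proof (rule inj_onI)
    fix c d assume c: "c \<in> S \<rightarrow>\<^sub>E UNIV" and d: "d \<in> S \<rightarrow>\<^sub>E UNIV" and e: "lincomb c S = lincomb d S"
    have "lincomb (\<lambda>v. c v - d v) S = lincomb c S \<ominus>\<^bsub>V\<^esub> lincomb d S"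
      using lincomb_diff[OF S, of c d] by simp
    also have "\<dots> = 0\<^sub>v n" unfolding e using lincomb_closed[OF S(2), of d] by (simp add: M.r_neg M.minus_eq)
    finally have "(\<lambda>v. c v - d v) \<in> S \<rightarrow> {0}" using not_lindepD[OF li S(1)] by auto
    then show "c = d" using c d by (intro PiE_ext) auto
  qed
  ultimately show ?thesis using S by (simp add: card_image card_PiE)
qed

lemma card_col_span:
  assumes fin: "finite (UNIV :: 'a set)" and A: "A \<in> carrier_mat n nc"
  shows "card (span (set (cols A))) = CARD('a) ^ rank A"
proof -
  let ?P = "\<lambda>T. T \<subseteq> set (cols A) \<and> lin_indpt T"
  have cols: "set (cols A) \<subseteq> carrier_vec n" using A by (auto simp: cols_def)
  obtain S where S: "finite S" "maximal S ?P"
    using maximal_exists_superset[of "set (cols A)" ?P "{}"] by (auto simp: lin_dep_def)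
  then have SP: "S \<subseteq> set (cols A)" "lin_indpt S" unfolding maximal_def by auto
  then have Sc: "S \<subseteq> carrier_vec n" using cols by auto
  have "set (cols A) \<subseteq> span S"
  proof
    fix c assume c: "c \<in> set (cols A)"
    show "c \<in> span S"
    proof (cases "c \<in> S")
      case False
      then have "\<not> ?P (insert c S)" using S(2) unfolding maximal_def by blast
      then have "lin_dep (S \<union> {c})" using SP c by auto
      then show ?thesis using lin_dep_iff_in_span[OF Sc SP(2) _ False] c cols by auto
    qed (use Sc in \<open>simp add: span_mem\<close>)
  qed
  then have "span (set (cols A)) = span S"
    using span_is_subset[OF _ span_is_submodule[OF Sc]] span_is_monotone[OF SP(1)] by blast
  then show ?thesis
    using card_span_lin_indpt[OF fin S(1) Sc SP(2)] rank_card_indpt[OF A S(2)] by simp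
qed

lemma card_rank_kernel:
  assumes fin: "finite (UNIV :: 'a set)" and A: "A \<in> carrier_mat n n"
  shows "CARD('a) ^ n = CARD('a) ^ rank A * card {x \<in> carrier_vec n. A *\<^sub>v x = 0\<^sub>v n}"
proof -
  have "span (set (cols A)) = (*\<^sub>v) A ` carrier_vec n"
    using col_space_eq[OF A] A unfolding col_space_def by auto
  then show ?thesis
    using card_carrier_vec_image_kernel[OF A] card_carrier_vec_finite[OF fin, of n]
      card_col_span[OF fin A] by simp
qed

end

definition mat_fun :: "nat \<Rightarrow> 'a mat \<Rightarrow> nat \<Rightarrow> nat \<Rightarrow> 'a::zero" where
  "mat_fun N A i j = (if i < N \<and> j < N then A $$ (i, j) else 0)"

definition hyp_orth_upper :: "nat \<Rightarrow> 'k::field mat \<Rightarrow> bool" where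
  "hyp_orth_upper n U \<longleftrightarrow> U \<in> carrier_mat (2*n) (2*n) \<and> upper_triangular U \<and>
     (\<forall>y \<in> carrier_vec (2*n). hquad n (($) (U *\<^sub>v y)) = hquad n (($) y))"

lemma hquad_cong: "(\<And>i. i < 2*m \<Longrightarrow> x i = y i) \<Longrightarrow> hquad m x = hquad m y"
  unfolding hquad_def by (intro sum.cong) auto

lemma matvec_mat_fun:
  assumes "A \<in> carrier_mat (2*m) (2*m)"
  shows "matvec m (mat_fun (2*m) A) x i = (if i < 2*m then (A *\<^sub>v vec (2*m) x) $ i else 0)"
  using assms by (auto simp: matvec_def mat_fun_def scalar_prod_def atLeast0LessThan intro!: sum.cong)

lemma upper_orth_mat_fun:
  assumes "hyp_orth_upper n U"
  shows "upper_orth (mat_fun (2*n) U) n"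
proof
  have U: "U \<in> carrier_mat (2*n) (2*n)" and ut: "upper_triangular U"
    and orth: "\<And>y. y \<in> carrier_vec (2*n) \<Longrightarrow> hquad n (($) (U *\<^sub>v y)) = hquad n (($) y)"
    using assms unfolding hyp_orth_upper_def by auto
  show "mat_fun (2*n) U i j = 0" if "j < i" for i j
    using that ut U by (auto simp: mat_fun_def upper_triangular_def)
  fix x :: "nat \<Rightarrow> 'a" assume "x \<in> window n 0"
  have "hquad n (matvec n (mat_fun (2*n) U) x) = hquad n (($) (U *\<^sub>v vec (2*n) x))"
    by (rule hquad_cong) (simp add: matvec_mat_fun[OF U])
  also have "\<dots> = hquad n (($) (vec (2*n) x))" by (rule orth) simp
  also have "\<dots> = hquad n x" by (rule hquad_cong) simp
  finally show "hquad n (matvec n (mat_fun (2*n) U) x) = hquad n x" .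
qed

text \<open>The diagonal entries of U pair up to 1 (upper_orth_step.diag_a_diag_opp).\<close>

lemma det_hyp_orth_upper:
  assumes "hyp_orth_upper n U"
  shows "det U = 1"
proof -
  have U: "U \<in> carrier_mat (2*n) (2*n)" and ut: "upper_triangular U"
    using assms unfolding hyp_orth_upper_def by auto
  interpret upper_orth "mat_fun (2*n) U" n by (rule upper_orth_mat_fun[OF assms])
  have pair: "U $$ (a, a) * U $$ (2*n-1-a, 2*n-1-a) = 1" if "a < n" for a
  proof -
    interpret upper_orth_step "mat_fun (2*n) U" n a by unfold_locales (rule that)
    show ?thesis using diag_a_diag_opp opp_bounds that
      by (simp add: diag_a_def diag_opp_def mat_fun_def)
  qed
  have "det U = (\<Prod>i = 0..<2*n. U $$ (i, i))"
    using det_upper_triangular[OF ut U] U by (simp add: prod_list_diag_prod)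
  also have "\<dots> = (\<Prod>a = 0..<n. U $$ (a, a)) * (\<Prod>i = n..<2*n. U $$ (i, i))"
    by (rule prod.atLeastLessThan_concat[symmetric]) auto
  also have "(\<Prod>i = n..<2*n. U $$ (i, i)) = (\<Prod>a = 0..<n. U $$ (2*n-1-a, 2*n-1-a))"
    by (rule prod.reindex_bij_witness[of _ "\<lambda>a. 2*n-1-a" "\<lambda>a. 2*n-1-a"]) auto
  also have "(\<Prod>a = 0..<n. U $$ (a, a)) * \<dots> = (\<Prod>a = 0..<n. U $$ (a, a) * U $$ (2*n-1-a, 2*n-1-a))"
    by (simp add: prod.distrib)
  also have "\<dots> = 1" using pair by (intro prod.neutral) auto
  finally show ?thesis .
qed

lemma index_swaprows_mult_vec:
  assumes x: "(x :: 'a::comm_ring_1 vec) \<in> carrier_vec N" and "i < N" "k < N" "l < N"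
  shows "(swaprows_mat N k l *\<^sub>v x) $ i = x $ (if i = k then l else if i = l then k else i)"
proof -
  let ?j = "if i = k then l else if i = l then k else i"
  have row: "row (swaprows_mat N k l) i = unit_vec N ?j"
    using assms by (cases "i = k"; cases "i = l") (auto simp: row_swaprows)
  have "(swaprows_mat N k l *\<^sub>v x) $ i = row (swaprows_mat N k l) i \<bullet> x"
    using assms by simp
  also have "\<dots> = unit_vec N ?j \<bullet> x" by (simp only: row)
  also have "\<dots> = x $ ?j" using assms by (intro scalar_prod_left_unit[OF x]) simp
  finally show ?thesis .
qed

lemma card_kernel_swap:
  fixes U :: "'k::field mat"
  assumes U: "U \<in> carrier_mat (2*n) (2*n)" and n: "0 < n"
  shows "card {x \<in> carrier_vec (2*n). (U * swaprows_mat (2*n) 0 (2*n-1) - 1\<^sub>m (2*n)) *\<^sub>v x = 0\<^sub>v (2*n)}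
    = card {f \<in> window n 0. matvec n (mat_fun (2*n) U) f = f(0 := f (2*n-1), 2*n-1 := f 0)}"
proof -
  let ?P = "swaprows_mat (2*n) 0 (2*n-1) :: 'k mat"
  define \<sigma> where "\<sigma> i = (if i = 0 then 2*n-1 else if i = 2*n-1 then 0 else i)" for i
  have \<sigma>_\<sigma>: "\<sigma> (\<sigma> i) = i" for i
    using n by (simp add: \<sigma>_def)
  have \<sigma>_less: "\<sigma> i < 2*n" if "i < 2*n" for i
    using n that by (simp add: \<sigma>_def)
  have \<sigma>_id: "\<sigma> i = i" if "2*n \<le> i" for i
    using n that by (simp add: \<sigma>_def)
  note \<sigma> = \<sigma>_\<sigma> \<sigma>_less \<sigma>_id
  have P: "?P \<in> carrier_mat (2*n) (2*n)" by (simp add: swaprows_mat_def)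
  have Px: "(?P *\<^sub>v x) $ i = x $ \<sigma> i" if "x \<in> carrier_vec (2*n)" "i < 2*n" for x i
    using index_swaprows_mult_vec[OF that] n by (simp add: \<sigma>_def)
  have swap: "f(0 := f (2*n-1), 2*n-1 := f 0) = f \<circ> \<sigma>" for f :: "nat \<Rightarrow> 'k"
    using n by (auto simp: \<sigma>_def fun_eq_iff)
  have kernel: "(U * ?P - 1\<^sub>m (2*n)) *\<^sub>v x = 0\<^sub>v (2*n) \<longleftrightarrow> U *\<^sub>v (?P *\<^sub>v x) = x"
    if x: "x \<in> carrier_vec (2*n)" for x
  proof -
    have "(U * ?P - 1\<^sub>m (2*n)) *\<^sub>v x = (U * ?P) *\<^sub>v x - 1\<^sub>m (2*n) *\<^sub>v x"
      using U P x by (intro minus_mult_distrib_mat_vec) auto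
    also have "\<dots> = U *\<^sub>v (?P *\<^sub>v x) - x" using assoc_mult_mat_vec[OF U P x] x by simp
    finally have "(U * ?P - 1\<^sub>m (2*n)) *\<^sub>v x = U *\<^sub>v (?P *\<^sub>v x) - x" .
    moreover have "U *\<^sub>v (?P *\<^sub>v x) \<in> carrier_vec (2*n)"
      using mult_mat_vec_carrier[OF U mult_mat_vec_carrier[OF P x]] .
    ultimately show ?thesis using x U by (auto simp: vec_eq_iff)
  qed
  define \<phi> where "\<phi> x = (\<lambda>i. if i < 2*n then x $ \<sigma> i else 0)" for x :: "'k vec"
  define \<psi> where "\<psi> f = vec (2*n) (f \<circ> \<sigma>)" for f :: "nat \<Rightarrow> 'k"
  have vec_\<phi>: "vec (2*n) (\<phi> x) = ?P *\<^sub>v x" if "x \<in> carrier_vec (2*n)" for x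
    using that Px by (auto simp: \<phi>_def intro!: eq_vecI)
  have "bij_betw \<phi> {x \<in> carrier_vec (2*n). (U * ?P - 1\<^sub>m (2*n)) *\<^sub>v x = 0\<^sub>v (2*n)}
      {f \<in> window n 0. matvec n (mat_fun (2*n) U) f = f(0 := f (2*n-1), 2*n-1 := f 0)}"
  proof (rule bij_betw_byWitness[where f' = \<psi>])
    show "\<forall>x \<in> {x \<in> carrier_vec (2*n). (U * ?P - 1\<^sub>m (2*n)) *\<^sub>v x = 0\<^sub>v (2*n)}. \<psi> (\<phi> x) = x"
      using \<sigma> by (auto simp: \<phi>_def \<psi>_def intro!: eq_vecI)
    show "\<forall>f \<in> {f \<in> window n 0. matvec n (mat_fun (2*n) U) f = f(0 := f (2*n-1), 2*n-1 := f 0)}.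
        \<phi> (\<psi> f) = f"
      using \<sigma> by (auto simp: \<phi>_def \<psi>_def window_def fun_eq_iff)
    show "\<phi> ` {x \<in> carrier_vec (2*n). (U * ?P - 1\<^sub>m (2*n)) *\<^sub>v x = 0\<^sub>v (2*n)}
        \<subseteq> {f \<in> window n 0. matvec n (mat_fun (2*n) U) f = f(0 := f (2*n-1), 2*n-1 := f 0)}"
    proof clarify
      fix x assume x: "x \<in> carrier_vec (2*n)" "(U * ?P - 1\<^sub>m (2*n)) *\<^sub>v x = 0\<^sub>v (2*n)"
      then have Ux: "U *\<^sub>v vec (2*n) (\<phi> x) = x" using kernel vec_\<phi> by simp
      have "matvec n (mat_fun (2*n) U) (\<phi> x) = \<phi> x \<circ> \<sigma>"
        using \<sigma> x(1) Ux by (auto simp: matvec_mat_fun[OF U] \<phi>_def fun_eq_iff)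
      moreover have "\<phi> x \<in> window n 0" by (simp add: \<phi>_def window_def)
      ultimately show "\<phi> x \<in> window n 0 \<and>
          matvec n (mat_fun (2*n) U) (\<phi> x) = (\<phi> x)(0 := \<phi> x (2*n-1), 2*n-1 := \<phi> x 0)"
        unfolding swap by simp
    qed
    show "\<psi> ` {f \<in> window n 0. matvec n (mat_fun (2*n) U) f = f(0 := f (2*n-1), 2*n-1 := f 0)}
        \<subseteq> {x \<in> carrier_vec (2*n). (U * ?P - 1\<^sub>m (2*n)) *\<^sub>v x = 0\<^sub>v (2*n)}"
    proof clarify
      fix f assume f: "f \<in> window n 0" "matvec n (mat_fun (2*n) U) f = f(0 := f (2*n-1), 2*n-1 := f 0)"
      have Uf: "(U *\<^sub>v vec (2*n) f) $ i = f (\<sigma> i)" if "i < 2*n" for i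
        using fun_cong[OF f(2)[unfolded swap], of i] that by (simp add: matvec_mat_fun[OF U])
      have "U *\<^sub>v vec (2*n) f = \<psi> f"
        using U by (intro eq_vecI) (auto simp: \<psi>_def Uf simp del: index_mult_mat_vec)
      moreover have "?P *\<^sub>v \<psi> f = vec (2*n) f"
        using \<sigma> Px[of "\<psi> f"] by (auto simp: \<psi>_def intro!: eq_vecI)
      ultimately show "\<psi> f \<in> carrier_vec (2*n) \<and> (U * ?P - 1\<^sub>m (2*n)) *\<^sub>v \<psi> f = 0\<^sub>v (2*n)"
        using kernel[of "\<psi> f"] by (simp add: \<psi>_def)
    qed
  qed
  then show ?thesis by (rule bij_betw_same_card)
qed

lemma odd_rank_hyp_orth_upper_swap:
  fixes U :: "'k::field mat"
  assumes fin: "finite (UNIV :: 'k set)" and n: "0 < n" and U: "hyp_orth_upper n U"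
  shows "odd (vec_space.rank (2*n) (U * swaprows_mat (2*n) 0 (2*n-1) - 1\<^sub>m (2*n)))"
proof -
  let ?A = "U * swaprows_mat (2*n) 0 (2*n-1) - 1\<^sub>m (2*n)"
  have Uc: "U \<in> carrier_mat (2*n) (2*n)" using U unfolding hyp_orth_upper_def by simp
  have A: "?A \<in> carrier_mat (2*n) (2*n)" by (rule minus_carrier_mat) simp
  interpret upper_orth "mat_fun (2*n) U" n by (rule upper_orth_mat_fun[OF U])
  obtain e where "card {x \<in> carrier_vec (2*n). ?A *\<^sub>v x = 0\<^sub>v (2*n)} = CARD('k) ^ (2*e + 1)"
    using odd_card_swap_fixed[OF fin n] card_kernel_swap[OF Uc n] by auto
  then have "CARD('k) ^ (2*n) = CARD('k) ^ (vec_space.rank (2*n) ?A + (2*e + 1))"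
    using vec_space.card_rank_kernel[OF fin A] by (simp add: power_add)
  moreover have "1 < CARD('k)" using card_UNIV_field_ge_2[OF fin] by simp
  ultimately have "2*n = vec_space.rank (2*n) ?A + (2*e + 1)"
    using power_inject_exp by blast
  then show ?thesis by presburger
qed

lemma det_hyp_orth_upper_swap:
  assumes n: "0 < n" and U: "hyp_orth_upper n U"
  shows "det (U * swaprows_mat (2*n) 0 (2*n-1)) = - 1"
proof -
  have "U \<in> carrier_mat (2*n) (2*n)" using U unfolding hyp_orth_upper_def by simp
  then have "det (U * swaprows_mat (2*n) 0 (2*n-1)) = det U * det (swaprows_mat (2*n) 0 (2*n-1) :: 'a mat)"
    by (intro det_mult) auto
  also have "det (swaprows_mat (2*n) 0 (2*n-1) :: 'a mat) = - 1"
    using n by (intro det_swaprows_mat) auto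
  finally show ?thesis using det_hyp_orth_upper[OF U] by simp
qed

lemma alpha_hyp_orth_upper_swap_nontrivial:
  fixes U :: "'k::field mat"
  assumes fin: "finite (UNIV :: 'k set)" and n: "0 < n" and U: "hyp_orth_upper n U"
  shows "\<not> (if (2::'k) \<noteq> 0 then det (U * swaprows_mat (2*n) 0 (2*n-1)) = 1
            else dickson_inv (2*n) (U * swaprows_mat (2*n) 0 (2*n-1)) = 0)"
proof (cases "(2::'k) = 0")
  case False
  then have "(- 1 :: 'k) \<noteq> 1" by (metis add_eq_0_iff one_add_one)
  then show ?thesis using False det_hyp_orth_upper_swap[OF n U] by simp
next
  case True
  then show ?thesis
    using odd_rank_hyp_orth_upper_swap[OF fin n U] by (simp add: dickson_inv_def odd_iff_mod_2_eq_one)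
qed

section \<open>Matrices over F\<close>

lemma SO_odd_carrier: "g \<in> SO_odd n \<Longrightarrow> g \<in> carrier_mat (2*n+1) (2*n+1)"
  unfolding SO_odd_def by auto

lemma SO_odd_mult:
  assumes g: "g \<in> SO_odd n" and h: "h \<in> SO_odd n"
  shows "g * h \<in> SO_odd n"
proof -
  have gc: "g \<in> carrier_mat (2*n+1) (2*n+1)" and hc: "h \<in> carrier_mat (2*n+1) (2*n+1)"
    using g h SO_odd_carrier by auto
  have "qform n ((g * h) *\<^sub>v x) = qform n x" if x: "x \<in> carrier_vec (2*n+1)" for x
  proof -
    have "(g * h) *\<^sub>v x = g *\<^sub>v (h *\<^sub>v x)" using gc hc x by simp
    moreover have "h *\<^sub>v x \<in> carrier_vec (2*n+1)" using hc x by simp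
    ultimately show ?thesis using g h x unfolding SO_odd_def by simp
  qed
  then show ?thesis using g h det_mult[OF gc hc] mult_carrier_mat[OF gc hc] unfolding SO_odd_def by simp
qed

lemma upper_triangular_left_inverse:
  assumes b: "b \<in> carrier_mat N N" and c: "c \<in> carrier_mat N N" and ut: "upper_triangular b"
    and diag: "\<And>i. i < N \<Longrightarrow> b $$ (i, i) \<noteq> (0::'a::field)" and cb: "c * b = 1\<^sub>m N"
  shows "upper_triangular c"
proof (rule upper_triangularI)
  fix i j assume "j < i" "i < dim_row c"
  then have i: "i < N" and "j < i" using c by auto
  then show "c $$ (i, j) = 0"
  proof (induction j rule: less_induct)
    case (less j)
    have "0 = (c * b) $$ (i, j)" using cb less.prems by simp
    also have "\<dots> = (\<Sum>k = 0..<N. c $$ (i, k) * b $$ (k, j))"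
      using b c less.prems by (simp add: scalar_prod_def)
    also have "\<dots> = (\<Sum>k = 0..<N. if k = j then c $$ (i, j) * b $$ (j, j) else 0)"
    proof (rule sum.cong[OF refl])
      fix k assume "k \<in> {0..<N}"
      then show "c $$ (i, k) * b $$ (k, j) = (if k = j then c $$ (i, j) * b $$ (j, j) else 0)"
        using less.IH[of k] less.prems ut b by (cases "k < j") (auto simp: upper_triangular_def)
    qed
    also have "\<dots> = c $$ (i, j) * b $$ (j, j)" using less.prems by simp
    finally show ?case using diag[of j] less.prems by simp
  qed
qed

lemma sum_insert_index:
  assumes "p < Suc N"
  shows "(\<Sum>k = 0..<Suc N. f k) = f p + (\<Sum>k = 0..<N. f (insert_index p k))"
proof -
  have "(\<Sum>k = 0..<Suc N. f k) = f p + (\<Sum>k \<in> {0..<Suc N} - {p}. f k)"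
    using assms by (subst sum.remove[of _ p]) auto
  also have "(\<Sum>k \<in> {0..<Suc N} - {p}. f k) = (\<Sum>k = 0..<N. f (insert_index p k))"
    unfolding insert_index_image[OF assms, symmetric]
    by (rule sum.reindex[OF insert_index_inj_on, unfolded comp_def])
  finally show ?thesis .
qed

lemma mat_delete_mult:
  assumes A: "A \<in> carrier_mat (Suc N) (Suc N)" and B: "B \<in> carrier_mat (Suc N) (Suc N)"
    and p: "p < Suc N" and Bp: "\<And>j. j < Suc N \<Longrightarrow> j \<noteq> p \<Longrightarrow> B $$ (p, j) = 0"
  shows "mat_delete (A * B) p p = mat_delete A p p * mat_delete B p p"
proof (rule eq_matI)
  fix i j assume "i < dim_row (mat_delete A p p * mat_delete B p p)"
    "j < dim_col (mat_delete A p p * mat_delete B p p)"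
  then have i: "i < N" and j: "j < N" using A B by auto
  let ?i = "insert_index p i" and ?j = "insert_index p j"
  have ij: "?i < Suc N" "?j < Suc N" using i j by (auto simp: insert_index_def)
  have "mat_delete (A * B) p p $$ (i, j) = (A * B) $$ (?i, ?j)"
    using mat_delete_index[OF mult_carrier_mat[OF A B] p p i j] by simp
  also have "\<dots> = (\<Sum>k = 0..<Suc N. A $$ (?i, k) * B $$ (k, ?j))"
    using A B ij by (simp add: scalar_prod_def)
  also have "\<dots> = (\<Sum>k = 0..<N. A $$ (?i, insert_index p k) * B $$ (insert_index p k, ?j))"
    unfolding sum_insert_index[OF p] using Bp[OF ij(2)] by simp
  also have "\<dots> = (\<Sum>k = 0..<N. mat_delete A p p $$ (i, k) * mat_delete B p p $$ (k, j))"
    using mat_delete_index[OF A p p i] mat_delete_index[OF B p p _ j] by (intro sum.cong) auto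
  also have "\<dots> = (mat_delete A p p * mat_delete B p p) $$ (i, j)"
    using A B i j by (simp add: scalar_prod_def)
  finally show "mat_delete (A * B) p p $$ (i, j) = (mat_delete A p p * mat_delete B p p) $$ (i, j)" .
qed (use A B in auto)

lemma index_mat_delete_mult_vec:
  assumes A: "A \<in> carrier_mat (Suc N) (Suc N)" and y: "y \<in> carrier_vec N"
    and p: "p < Suc N" and i: "i < N"
  shows "(mat_delete A p p *\<^sub>v y) $ i =
    (A *\<^sub>v vec (Suc N) (\<lambda>k. if k = p then 0 else y $ delete_index p k)) $ insert_index p i"
proof -
  let ?y = "vec (Suc N) (\<lambda>k. if k = p then 0 else y $ delete_index p k)"
  have ins: "insert_index p k < Suc N" if "k < N" for k
    using that by (simp add: insert_index_def)
  have "(A *\<^sub>v ?y) $ insert_index p i = (\<Sum>k = 0..<Suc N. A $$ (insert_index p i, k) * ?y $ k)"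
    using A ins[OF i] by (simp add: scalar_prod_def)
  also have "\<dots> = (\<Sum>k = 0..<N. A $$ (insert_index p i, insert_index p k) * y $ k)"
    unfolding sum_insert_index[OF p] using ins p by simp
  also have "\<dots> = (mat_delete A p p *\<^sub>v y) $ i"
    using A y i mat_delete_index[OF A p p i] by (simp add: scalar_prod_def)
  finally show ?thesis by simp
qed

lemma lattice_L_iff:
  "x \<in> lattice_L v n \<longleftrightarrow> x \<in> carrier_vec (2*n+1) \<and>
     (\<forall>i < 2*n+1. x $ i \<in> (if i < n then Oring v else pideal v))"
  unfolding lattice_L_def by simp

lemma stabilizes_L_mult:
  assumes A: "A \<in> carrier_mat (2*n+1) (2*n+1)" and B: "B \<in> carrier_mat (2*n+1) (2*n+1)"
    and AL: "(\<lambda>x. A *\<^sub>v x) ` lattice_L v n = lattice_L v n"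
    and BL: "(\<lambda>x. B *\<^sub>v x) ` lattice_L v n = lattice_L v n"
  shows "(\<lambda>x. (A * B) *\<^sub>v x) ` lattice_L v n = lattice_L v n"
proof -
  have "(\<lambda>x. (A * B) *\<^sub>v x) ` lattice_L v n = (\<lambda>x. A *\<^sub>v x) ` (\<lambda>x. B *\<^sub>v x) ` lattice_L v n"
    unfolding image_image using A B by (intro image_cong) (auto simp: lattice_L_def)
  then show ?thesis using AL BL by simp
qed

lemma Borel_diag_nonzero:
  assumes b: "b \<in> Borel n" and i: "i < 2*n+1"
  shows "b $$ (i, i) \<noteq> 0"
proof
  assume "b $$ (i, i) = 0"
  have bc: "b \<in> carrier_mat (2*n+1) (2*n+1)" and "upper_triangular b"
    using b unfolding Borel_def SO_odd_def by (auto simp: upper_triangular_def)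
  then have "det b = (\<Prod>k = 0..<2*n+1. b $$ (k, k))"
    by (simp add: det_upper_triangular prod_list_diag_prod)
  also have "\<dots> = 0" using \<open>b $$ (i, i) = 0\<close> i by (intro prod_zero) auto
  finally show False using b unfolding Borel_def SO_odd_def by simp
qed

definition Lscale :: "'a::field \<Rightarrow> nat \<Rightarrow> nat \<Rightarrow> 'a" where
  "Lscale w n i = (if i < n then 1 else w)"

definition L_coords :: "'a::field \<Rightarrow> nat \<Rightarrow> 'a mat \<Rightarrow> 'a mat" where
  "L_coords w n A = Lbasis_inv w n * A * Lbasis w n"

lemma Lbasis_mat_diag: "Lbasis w n = mat_diag (2*n+1) (Lscale w n)"
  unfolding Lbasis_def mat_diag_def Lscale_def by (rule cong_mat) auto

lemma Lbasis_inv_mat_diag: "Lbasis_inv w n = mat_diag (2*n+1) (\<lambda>i. inverse (Lscale w n i))"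
  unfolding Lbasis_inv_def mat_diag_def Lscale_def by (rule cong_mat) auto

lemma Lbasis_carrier [simp]: "Lbasis w n \<in> carrier_mat (2*n+1) (2*n+1)"
  by (simp add: Lbasis_mat_diag)

lemma Lbasis_dim [simp]:
  "dim_row (Lbasis w n) = 2*n+1" "dim_col (Lbasis w n) = 2*n+1"
  "dim_row (Lbasis_inv w n) = 2*n+1" "dim_col (Lbasis_inv w n) = 2*n+1"
  by (simp_all add: Lbasis_def Lbasis_inv_def)

lemma index_Lbasis_mult_vec:
  assumes "u \<in> carrier_vec (2*n+1)" "i < 2*n+1"
  shows "(Lbasis w n *\<^sub>v u) $ i = Lscale w n i * u $ i"
proof -
  have "(Lbasis w n *\<^sub>v u) $ i = (\<Sum>k \<in> {0..<2*n+1}. Lbasis w n $$ (i, k) * u $ k)"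
    using assms by (simp add: scalar_prod_def)
  also have "\<dots> = (\<Sum>k \<in> {0..<2*n+1}. if k = i then Lscale w n i * u $ k else 0)"
    using assms by (intro sum.cong) (auto simp: Lbasis_def Lscale_def)
  finally show ?thesis using assms by simp
qed

lemma L_coords_eq:
  assumes A: "A \<in> carrier_mat (2*n+1) (2*n+1)"
  shows "L_coords w n A = mat (2*n+1) (2*n+1) (\<lambda>(i, j). inverse (Lscale w n i) * A $$ (i, j) * Lscale w n j)"
proof -
  let ?M = "mat (2*n+1) (2*n+1) (\<lambda>(i, j). inverse (Lscale w n i) * A $$ (i, j))"
  have "Lbasis_inv w n * A = ?M"
    unfolding Lbasis_inv_mat_diag by (rule mat_diag_mult_left[OF A])
  moreover have "?M * mat_diag (2*n+1) (Lscale w n) = mat (2*n+1) (2*n+1) (\<lambda>(i, j). ?M $$ (i, j) * Lscale w n j)"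
    by (rule mat_diag_mult_right) simp
  ultimately show ?thesis unfolding L_coords_def Lbasis_mat_diag by (auto intro: cong_mat)
qed

lemma L_coords_dim [simp]: "dim_row (L_coords w n A) = 2*n+1" "dim_col (L_coords w n A) = 2*n+1"
  by (simp_all add: L_coords_def)

lemma index_L_coords:
  assumes "A \<in> carrier_mat (2*n+1) (2*n+1)" "i < 2*n+1" "j < 2*n+1"
  shows "L_coords w n A $$ (i, j) = inverse (Lscale w n i) * A $$ (i, j) * Lscale w n j"
  using assms by (simp add: L_coords_eq)

lemma L_coords_carrier:
  "A \<in> carrier_mat (2*n+1) (2*n+1) \<Longrightarrow> L_coords w n A \<in> carrier_mat (2*n+1) (2*n+1)"
  by (simp add: L_coords_eq)

lemma L_coords_mult:
  assumes w: "w \<noteq> 0" and A: "A \<in> carrier_mat (2*n+1) (2*n+1)" and B: "B \<in> carrier_mat (2*n+1) (2*n+1)"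
  shows "L_coords w n (A * B) = L_coords w n A * L_coords w n B"
proof (rule eq_matI)
  fix i j assume "i < dim_row (L_coords w n A * L_coords w n B)" "j < dim_col (L_coords w n A * L_coords w n B)"
  then have i: "i < 2*n+1" and j: "j < 2*n+1" using L_coords_carrier[OF A] L_coords_carrier[OF B] by auto
  have s: "Lscale w n k * inverse (Lscale w n k) = 1" for k using w by (simp add: Lscale_def)
  have "(L_coords w n A * L_coords w n B) $$ (i, j)
      = (\<Sum>k = 0..<2*n+1. L_coords w n A $$ (i, k) * L_coords w n B $$ (k, j))"
    using L_coords_carrier[OF A] L_coords_carrier[OF B] i j by (simp add: scalar_prod_def)
  also have "\<dots> = (\<Sum>k = 0..<2*n+1. inverse (Lscale w n i) * (A $$ (i, k) * B $$ (k, j)) * Lscale w n j)"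
  proof (rule sum.cong[OF refl])
    fix k assume "k \<in> {0..<2*n+1}"
    then show "L_coords w n A $$ (i, k) * L_coords w n B $$ (k, j)
        = inverse (Lscale w n i) * (A $$ (i, k) * B $$ (k, j)) * Lscale w n j"
      using i j s[of k] by (simp add: L_coords_eq[OF A] L_coords_eq[OF B] ac_simps)
  qed
  also have "\<dots> = inverse (Lscale w n i) * (\<Sum>k = 0..<2*n+1. A $$ (i, k) * B $$ (k, j)) * Lscale w n j"
    by (simp only: sum_distrib_left sum_distrib_right mult.assoc)
  also have "\<dots> = inverse (Lscale w n i) * (A * B) $$ (i, j) * Lscale w n j"
    using A B i j by (simp add: scalar_prod_def)
  also have "\<dots> = L_coords w n (A * B) $$ (i, j)"
    using index_L_coords[OF mult_carrier_mat[OF A B] i j] by simp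
  finally show "L_coords w n (A * B) $$ (i, j) = (L_coords w n A * L_coords w n B) $$ (i, j)" by simp
qed (use L_coords_carrier[OF A] L_coords_carrier[OF B] L_coords_carrier[OF mult_carrier_mat[OF A B]] in auto)

lemma mult_vec_Lbasis:
  assumes w: "w \<noteq> 0" and A: "A \<in> carrier_mat (2*n+1) (2*n+1)" and x: "x \<in> carrier_vec (2*n+1)"
  shows "A *\<^sub>v (Lbasis w n *\<^sub>v x) = Lbasis w n *\<^sub>v (L_coords w n A *\<^sub>v x)"
proof -
  have "Lbasis w n * L_coords w n A = mat (2*n+1) (2*n+1) (\<lambda>(i, j). Lscale w n i * L_coords w n A $$ (i, j))"
    using mat_diag_mult_left[OF L_coords_carrier[OF A], of "Lscale w n"]
    unfolding Lbasis_mat_diag[symmetric] .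
  also have "\<dots> = mat (2*n+1) (2*n+1) (\<lambda>(i, j). A $$ (i, j) * Lscale w n j)"
    using w by (intro cong_mat) (auto simp: L_coords_eq[OF A] Lscale_def)
  also have "\<dots> = A * Lbasis w n"
    using mat_diag_mult_right[OF A, of "Lscale w n"] unfolding Lbasis_mat_diag[symmetric] ..
  finally have "Lbasis w n * L_coords w n A = A * Lbasis w n" .
  then show ?thesis
    using A x by (metis Lbasis_carrier L_coords_carrier assoc_mult_mat_vec)
qed

text \<open>swap_elt w n sends e_1 to w f_1 and f_1 to w^-1 e_1, negates v_0 and fixes the other basis
  vectors; it lies in SO_{2n+1}(F) and stabilises L.\<close>

definition swap_index :: "nat \<Rightarrow> nat \<Rightarrow> nat" where
  "swap_index n i = (if i = 0 then 2*n else if i = 2*n then 0 else i)"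

definition swap_coeff :: "'a::field \<Rightarrow> nat \<Rightarrow> nat \<Rightarrow> 'a" where
  "swap_coeff w n i = (if i = 0 then inverse w else if i = 2*n then w else if i = n then -1 else 1)"

definition swap_elt :: "'a::field \<Rightarrow> nat \<Rightarrow> 'a mat" where
  "swap_elt w n = mat (2*n+1) (2*n+1) (\<lambda>(i, j). if j = swap_index n i then swap_coeff w n i else 0)"

lemma swap_elt_carrier [simp]: "swap_elt w n \<in> carrier_mat (2*n+1) (2*n+1)"
  by (simp add: swap_elt_def)

lemma swap_elt_dim [simp]: "dim_row (swap_elt w n) = 2*n+1" "dim_col (swap_elt w n) = 2*n+1"
  by (simp_all add: swap_elt_def)

lemma swap_index_less: "i < 2*n+1 \<Longrightarrow> swap_index n i < 2*n+1"
  by (simp add: swap_index_def)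

lemma index_swap_elt_mult_vec:
  assumes "x \<in> carrier_vec (2*n+1)" "i < 2*n+1"
  shows "(swap_elt w n *\<^sub>v x) $ i = swap_coeff w n i * x $ swap_index n i"
proof -
  have "(swap_elt w n *\<^sub>v x) $ i = (\<Sum>k \<in> {0..<2*n+1}. swap_elt w n $$ (i, k) * x $ k)"
    using assms by (simp add: scalar_prod_def)
  also have "\<dots> = (\<Sum>k \<in> {0..<2*n+1}. if k = swap_index n i then swap_coeff w n i * x $ k else 0)"
    using assms by (intro sum.cong) (auto simp: swap_elt_def)
  also have "\<dots> = swap_coeff w n i * x $ swap_index n i"
    using swap_index_less[OF assms(2)] by (simp only: sum.delta finite_atLeastLessThan) simp
  finally show ?thesis .
qed

lemma swap_elt_involution:
  assumes "0 < n" "w \<noteq> 0"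
  shows "swap_elt w n * swap_elt w n = 1\<^sub>m (2*n+1)"
proof (rule eq_matI)
  fix i j assume "i < dim_row (1\<^sub>m (2*n+1) :: 'a mat)" "j < dim_col (1\<^sub>m (2*n+1) :: 'a mat)"
  then have i: "i < 2*n+1" and j: "j < 2*n+1" by auto
  have "(swap_elt w n * swap_elt w n) $$ (i, j) = (swap_elt w n *\<^sub>v col (swap_elt w n) j) $ i"
    using i j by simp
  also have "\<dots> = swap_coeff w n i * swap_elt w n $$ (swap_index n i, j)"
  proof -
    have c: "col (swap_elt w n) j \<in> carrier_vec (2*n+1)" using col_dim[of "swap_elt w n" j] by simp
    show ?thesis using index_swap_elt_mult_vec[OF c i] j swap_index_less[OF i] by simp
  qed
  also have "\<dots> = 1\<^sub>m (2*n+1) $$ (i, j)"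
    using assms i j swap_index_less[OF i]
    by (auto simp: swap_elt_def swap_index_def swap_coeff_def)
  finally show "(swap_elt w n * swap_elt w n) $$ (i, j) = 1\<^sub>m (2*n+1) $$ (i, j)" .
qed auto

lemma det_swap_elt:
  assumes n: "0 < n" and w: "w \<noteq> 0"
  shows "det (swap_elt w n) = 1"
proof -
  define d where "d i = (if i = 0 then w else if i = 2*n then inverse w else if i = n then -1 else 1)" for i
  let ?S = "swaprows_mat (2*n+1) 0 (2*n) :: 'a mat"
  have "swap_elt w n = mat (2*n+1) (2*n+1) (\<lambda>(i, j). ?S $$ (i, j) * d j)"
    using n unfolding swap_elt_def by (intro cong_mat) (auto simp: swap_index_def swap_coeff_def d_def)
  also have "\<dots> = ?S * mat_diag (2*n+1) d"
    by (rule mat_diag_mult_right[symmetric]) simp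
  finally have eq: "swap_elt w n = ?S * mat_diag (2*n+1) d" .
  have "det (mat_diag (2*n+1) d) = (\<Prod>i = 0..<2*n+1. d i)"
    by (subst det_upper_triangular) (auto simp: mat_diag_def prod_list_diag_prod)
  also have "\<dots> = (\<Prod>i = 0..<2*n+1. (if i = 0 then w else 1) * (if i = 2*n then inverse w else 1)
      * (if i = n then -1 else 1))"
    using n by (intro prod.cong) (auto simp: d_def)
  also have "\<dots> = - 1" using w by (simp add: prod.distrib)
  finally have "det (mat_diag (2*n+1) d) = - 1" .
  moreover have "det ?S = - 1" using n by (intro det_swaprows_mat) auto
  ultimately show ?thesis unfolding eq by (simp add: det_mult[of _ "2*n+1"])
qed

lemma qform_eq:
  assumes x: "(x :: 'a::field_char_0 vec) \<in> carrier_vec (2*n+1)"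
  shows "qform n x = (\<Sum>i<n. x $ i * x $ (2*n-i)) + x $ n * x $ n"
proof -
  let ?c = "\<lambda>i. if i = n then 2 else (1::'a)" and ?f = "\<lambda>i. x $ i * x $ (2*n-i)"
  have gx: "(gram n *\<^sub>v x) $ i = ?c i * x $ (2*n-i)" if i: "i < 2*n+1" for i
  proof -
    have "row (gram n) i = ?c i \<cdot>\<^sub>v unit_vec (2*n+1) (2*n-i)"
      using i by (intro eq_vecI) (auto simp: gram_def unit_vec_def)
    moreover have "(gram n *\<^sub>v x) $ i = row (gram n) i \<bullet> x"
      using i by (simp add: gram_def)
    ultimately show ?thesis using x i by simp
  qed
  have "x \<bullet> (gram n *\<^sub>v x) = (\<Sum>i \<in> {0..<2*n+1}. ?c i * ?f i)"
    unfolding scalar_prod_def using x gx by (intro sum.cong) (auto simp: gram_def mult.left_commute)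
  also have "{0..<2*n+1} = {0..<n} \<union> {n} \<union> {n+1..<2*n+1}" by auto
  also have "(\<Sum>i \<in> {0..<n} \<union> {n} \<union> {n+1..<2*n+1}. ?c i * ?f i)
      = (\<Sum>i = 0..<n. ?f i) + 2 * ?f n + (\<Sum>i = n+1..<2*n+1. ?f i)"
    by (subst sum.union_disjoint; auto)+
  also have "(\<Sum>i = n+1..<2*n+1. ?f i) = (\<Sum>i = 0..<n. ?f i)"
    by (rule sum.reindex_bij_witness[of _ "\<lambda>i. 2*n-i" "\<lambda>i. 2*n-i"]) (auto simp: mult.commute)
  finally have "x \<bullet> (gram n *\<^sub>v x) = 2 * ((\<Sum>i = 0..<n. ?f i) + ?f n)" by simp
  then show ?thesis unfolding qform_def by (simp add: atLeast0LessThan)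
qed

lemma swap_elt_SO:
  assumes n: "0 < n" and w: "(w :: 'a::field_char_0) \<noteq> 0"
  shows "swap_elt w n \<in> SO_odd n"
proof -
  have "qform n (swap_elt w n *\<^sub>v x) = qform n x" if x: "x \<in> carrier_vec (2*n+1)" for x
  proof -
    have gx: "swap_elt w n *\<^sub>v x \<in> carrier_vec (2*n+1)"
      using mult_mat_vec_carrier[OF swap_elt_carrier x] .
    have "(swap_elt w n *\<^sub>v x) $ i * (swap_elt w n *\<^sub>v x) $ (2*n-i) = x $ i * x $ (2*n-i)"
      if "i < n" for i
      using that n w index_swap_elt_mult_vec[OF x, of i] index_swap_elt_mult_vec[OF x, of "2*n-i"]
      by (cases "i = 0") (auto simp: swap_index_def swap_coeff_def)
    moreover have "(swap_elt w n *\<^sub>v x) $ n * (swap_elt w n *\<^sub>v x) $ n = x $ n * x $ n"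
      using n index_swap_elt_mult_vec[OF x, of n] by (simp add: swap_index_def swap_coeff_def)
    ultimately show ?thesis unfolding qform_eq[OF gx] qform_eq[OF x] by simp
  qed
  then show ?thesis unfolding SO_odd_def using det_swap_elt[OF n w] swap_elt_carrier[of w n] by simp
qed

section \<open>The lattice L and reduction modulo p\<close>

locale nonarch_lf =
  fixes v :: "'a::field_char_0 \<Rightarrow> int" and res :: "'a \<Rightarrow> 'k::field" and w :: 'a
  assumes local_field: "nonarch_local_field_char0 v res"
    and w_nonzero: "w \<noteq> 0" and v_w: "v w = 1"
begin

lemma v_mult: "x \<noteq> 0 \<Longrightarrow> y \<noteq> 0 \<Longrightarrow> v (x * y) = v x + v y"
  using local_field unfolding nonarch_local_field_char0_def by blast

lemma v_add: "x \<noteq> 0 \<Longrightarrow> y \<noteq> 0 \<Longrightarrow> x + y \<noteq> 0 \<Longrightarrow> min (v x) (v y) \<le> v (x + y)"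
  using local_field unfolding nonarch_local_field_char0_def by blast

lemma res_add: "x \<in> Oring v \<Longrightarrow> y \<in> Oring v \<Longrightarrow> res (x + y) = res x + res y"
  using local_field unfolding nonarch_local_field_char0_def by blast

lemma res_mult: "x \<in> Oring v \<Longrightarrow> y \<in> Oring v \<Longrightarrow> res (x * y) = res x * res y"
  using local_field unfolding nonarch_local_field_char0_def by blast

lemma res_one: "res 1 = 1"
  using local_field unfolding nonarch_local_field_char0_def by blast

lemma res_surj: "\<exists>a \<in> Oring v. res a = y"
  using local_field unfolding nonarch_local_field_char0_def by (metis UNIV_I image_iff)

lemma res_eq_0_iff: "x \<in> Oring v \<Longrightarrow> res x = 0 \<longleftrightarrow> x \<in> pideal v"
  using local_field unfolding nonarch_local_field_char0_def by blast

lemma finite_residue_field: "finite (UNIV :: 'k set)"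
  using local_field unfolding nonarch_local_field_char0_def by blast

lemma v_one: "v 1 = 0"
  using v_mult[of 1 1] by simp

lemma v_inverse: "x \<noteq> 0 \<Longrightarrow> v (inverse x) = - v x"
  using v_mult[of x "inverse x"] v_one by simp

lemma v_uminus: "x \<noteq> 0 \<Longrightarrow> v (- x) = v x"
  using v_mult[of "-1" "-1"] v_mult[of "-1" x] v_one by simp

lemma Oring_zero [simp]: "0 \<in> Oring v"
  by (simp add: vball_def)

lemma Oring_mult: "x \<in> Oring v \<Longrightarrow> y \<in> Oring v \<Longrightarrow> x * y \<in> Oring v"
  unfolding vball_def by (cases "x = 0 \<or> y = 0") (auto simp: v_mult)

lemma Oring_add: "x \<in> Oring v \<Longrightarrow> y \<in> Oring v \<Longrightarrow> x + y \<in> Oring v"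
  unfolding vball_def using v_add[of x y] by fastforce

lemma Oring_sum: "(\<And>i. i \<in> A \<Longrightarrow> f i \<in> Oring v) \<Longrightarrow> sum f A \<in> Oring v"
  by (induction A rule: infinite_finite_induct) (auto intro!: Oring_add)

lemma pideal_uminus: "x \<in> pideal v \<Longrightarrow> - x \<in> pideal v"
  unfolding vball_def by (cases "x = 0") (auto simp: v_uminus)

lemma w_Oring: "w \<in> Oring v"
  by (simp add: vball_def v_w)

lemma pideal_mult_inverse_w: "x \<in> pideal v \<Longrightarrow> x * inverse w \<in> Oring v"
  unfolding vball_def using v_mult[of x "inverse w"] v_inverse[OF w_nonzero] v_w w_nonzero
  by (cases "x = 0") auto

lemma w_mult_Oring: "x \<in> Oring v \<Longrightarrow> w * x \<in> pideal v"
  unfolding vball_def using v_mult[of w x] v_w w_nonzero by (cases "x = 0") auto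

lemma res_zero [simp]: "res 0 = 0"
proof -
  have "res (0 + 0) = res 0 + res 0" by (rule res_add) simp_all
  then show ?thesis by (metis add_cancel_right_right add_0)
qed

lemma res_uminus_one: "res (- 1) = - 1"
proof -
  have "res (1 + - 1) = res 1 + res (- 1)" by (rule res_add) (auto simp: vball_def v_uminus v_one)
  then show ?thesis using res_one by (simp add: eq_neg_iff_add_eq_0 add.commute)
qed

lemma res_w: "res w = 0"
  using res_eq_0_iff[OF w_Oring] v_w by (simp add: vball_def)

lemma res_sum: "(\<And>i. i \<in> A \<Longrightarrow> f i \<in> Oring v) \<Longrightarrow> res (sum f A) = (\<Sum>i\<in>A. res (f i))"
  by (induction A rule: infinite_finite_induct) (auto simp: res_add Oring_sum)

lemma swap_elt_maps_L:
  assumes n: "0 < n" and x: "x \<in> lattice_L v n"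
  shows "swap_elt w n *\<^sub>v x \<in> lattice_L v n"
  unfolding lattice_L_iff
proof (intro conjI allI impI)
  have xc: "x \<in> carrier_vec (2*n+1)"
    and xi: "\<And>i. i < 2*n+1 \<Longrightarrow> x $ i \<in> (if i < n then Oring v else pideal v)"
    using x unfolding lattice_L_iff by auto
  show "swap_elt w n *\<^sub>v x \<in> carrier_vec (2*n+1)" using mult_mat_vec_carrier[OF swap_elt_carrier xc] .
  fix i assume i: "i < 2*n+1"
  have "x $ (2*n) * inverse w \<in> Oring v" using xi[of "2*n"] n by (intro pideal_mult_inverse_w) simp
  moreover have "w * x $ 0 \<in> pideal v" using xi[of 0] n by (intro w_mult_Oring) simp
  moreover have "- x $ n \<in> pideal v" using xi[of n] n by (intro pideal_uminus) simp
  ultimately show "(swap_elt w n *\<^sub>v x) $ i \<in> (if i < n then Oring v else pideal v)"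
    using xi[OF i] n i unfolding index_swap_elt_mult_vec[OF xc i]
    by (auto simp: swap_index_def swap_coeff_def mult.commute)
qed

lemma swap_elt_stabilizes_L:
  assumes n: "0 < n"
  shows "(\<lambda>x. swap_elt w n *\<^sub>v x) ` lattice_L v n = lattice_L v n"
proof
  show "(\<lambda>x. swap_elt w n *\<^sub>v x) ` lattice_L v n \<subseteq> lattice_L v n"
    using swap_elt_maps_L[OF n] by auto
  show "lattice_L v n \<subseteq> (\<lambda>x. swap_elt w n *\<^sub>v x) ` lattice_L v n"
  proof
    fix x assume x: "x \<in> lattice_L v n"
    then have "x = swap_elt w n *\<^sub>v (swap_elt w n *\<^sub>v x)"
      using swap_elt_involution[OF n w_nonzero]
      by (metis assoc_mult_mat_vec lattice_L_iff one_mult_mat_vec swap_elt_carrier)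
    then show "x \<in> (\<lambda>x. swap_elt w n *\<^sub>v x) ` lattice_L v n"
      using swap_elt_maps_L[OF n x] by blast
  qed
qed

lemma L_coords_integral:
  assumes A: "A \<in> carrier_mat (2*n+1) (2*n+1)"
    and AL: "(\<lambda>x. A *\<^sub>v x) ` lattice_L v n \<subseteq> lattice_L v n"
    and i: "i < 2*n+1" and j: "j < 2*n+1"
  shows "L_coords w n A $$ (i, j) \<in> Oring v"
proof -
  have "Lscale w n j \<cdot>\<^sub>v unit_vec (2*n+1) j \<in> lattice_L v n"
    using j by (auto simp: lattice_L_iff Lscale_def unit_vec_def vball_def v_w v_one)
  then have "A *\<^sub>v (Lscale w n j \<cdot>\<^sub>v unit_vec (2*n+1) j) \<in> lattice_L v n" using AL by blast
  moreover have "(A *\<^sub>v (Lscale w n j \<cdot>\<^sub>v unit_vec (2*n+1) j)) $ i = A $$ (i, j) * Lscale w n j"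
    using A i j by (simp add: mult_mat_vec)
  ultimately have h: "A $$ (i, j) * Lscale w n j \<in> (if i < n then Oring v else pideal v)"
    using i unfolding lattice_L_iff by metis
  have e: "L_coords w n A $$ (i, j) = inverse (Lscale w n i) * (A $$ (i, j) * Lscale w n j)"
    using index_L_coords[OF A i j, where w = w] by (simp add: mult.assoc)
  show ?thesis
  proof (cases "i < n")
    case True
    then show ?thesis using h unfolding e by (simp add: Lscale_def)
  next
    case False
    then have "A $$ (i, j) * Lscale w n j * inverse w \<in> Oring v"
      using h by (intro pideal_mult_inverse_w) simp
    then show ?thesis using False unfolding e by (simp add: Lscale_def mult.commute)
  qed
qed

lemma map_mat_res_mult:
  assumes A: "A \<in> carrier_mat N N" and B: "B \<in> carrier_mat N N"
    and AO: "\<And>i j. i < N \<Longrightarrow> j < N \<Longrightarrow> A $$ (i, j) \<in> Oring v"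
    and BO: "\<And>i j. i < N \<Longrightarrow> j < N \<Longrightarrow> B $$ (i, j) \<in> Oring v"
  shows "map_mat res (A * B) = map_mat res A * map_mat res B"
proof (rule eq_matI)
  fix i j assume "i < dim_row (map_mat res A * map_mat res B)" "j < dim_col (map_mat res A * map_mat res B)"
  then have i: "i < N" and j: "j < N" using A B by auto
  have "map_mat res (A * B) $$ (i, j) = res (\<Sum>k = 0..<N. A $$ (i, k) * B $$ (k, j))"
    using A B i j by (simp add: scalar_prod_def)
  also have "\<dots> = (\<Sum>k = 0..<N. res (A $$ (i, k)) * res (B $$ (k, j)))"
    using AO BO i j by (subst res_sum) (auto intro!: sum.cong Oring_mult res_mult)
  also have "\<dots> = (map_mat res A * map_mat res B) $$ (i, j)"
    using A B i j by (simp add: scalar_prod_def)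
  finally show "map_mat res (A * B) $$ (i, j) = (map_mat res A * map_mat res B) $$ (i, j)" .
qed (use A B in auto)

lemma index_reduced_swap_elt:
  assumes n: "0 < n" and i: "i < 2*n+1" and j: "j < 2*n+1"
  shows "map_mat res (L_coords w n (swap_elt w n)) $$ (i, j) =
    (if j = swap_index n i then if i = n then -1 else 1 else 0)"
proof -
  have "L_coords w n (swap_elt w n) $$ (i, j) = (if j = swap_index n i then if i = n then -1 else 1 else 0)"
    using n i j w_nonzero unfolding index_L_coords[OF swap_elt_carrier i j]
    by (auto simp: swap_elt_def swap_index_def swap_coeff_def Lscale_def)
  then show ?thesis using i j res_one res_uminus_one by simp
qed

lemma reduced_swap_elt:
  assumes n: "0 < n"
  shows "mat_delete (map_mat res (L_coords w n (swap_elt w n))) n n = swaprows_mat (2*n) 0 (2*n-1)"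
proof (rule eq_matI)
  have c: "map_mat res (L_coords w n (swap_elt w n)) \<in> carrier_mat (Suc (2*n)) (Suc (2*n))"
    using L_coords_carrier[OF swap_elt_carrier] by simp
  fix i j assume "i < dim_row (swaprows_mat (2*n) 0 (2*n-1) :: 'k mat)"
    "j < dim_col (swaprows_mat (2*n) 0 (2*n-1) :: 'k mat)"
  then have i: "i < 2*n" and j: "j < 2*n" by auto
  have "mat_delete (map_mat res (L_coords w n (swap_elt w n))) n n $$ (i, j) =
      map_mat res (L_coords w n (swap_elt w n)) $$ (insert_index n i, insert_index n j)"
    using mat_delete_index[OF c _ _ i j] by simp
  also have "\<dots> = swaprows_mat (2*n) 0 (2*n-1) $$ (i, j)"
    using n i j by (subst index_reduced_swap_elt) (auto simp: insert_index_def swap_index_def)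
  finally show "mat_delete (map_mat res (L_coords w n (swap_elt w n))) n n $$ (i, j) =
      swaprows_mat (2*n) 0 (2*n-1) $$ (i, j)" .
qed auto

text \<open>The form q/w in the coordinates of the basis (e_1, ..., e_n, w v_0, w f_n, ..., w f_1) of L.\<close>

definition Lform :: "nat \<Rightarrow> 'a vec \<Rightarrow> 'a" where
  "Lform n t = (\<Sum>i<n. t $ i * t $ (2*n-i)) + w * (t $ n * t $ n)"

lemma qform_Lbasis:
  assumes u: "u \<in> carrier_vec (2*n+1)"
  shows "qform n (Lbasis w n *\<^sub>v u) = w * Lform n u"
proof -
  have Lu: "Lbasis w n *\<^sub>v u \<in> carrier_vec (2*n+1)" using mult_mat_vec_carrier[OF Lbasis_carrier u] .
  have "(Lbasis w n *\<^sub>v u) $ i * (Lbasis w n *\<^sub>v u) $ (2*n-i) = w * (u $ i * u $ (2*n-i))" if "i < n" for i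
    using that u by (simp add: index_Lbasis_mult_vec Lscale_def del: index_mult_mat_vec)
  moreover have "(Lbasis w n *\<^sub>v u) $ n * (Lbasis w n *\<^sub>v u) $ n = w * (w * (u $ n * u $ n))"
    using u by (simp add: index_Lbasis_mult_vec Lscale_def del: index_mult_mat_vec)
  ultimately show ?thesis
    unfolding qform_eq[OF Lu] Lform_def by (simp add: sum_distrib_left algebra_simps)
qed

lemma Lform_L_coords:
  assumes c: "c \<in> SO_odd n" and x: "x \<in> carrier_vec (2*n+1)"
  shows "Lform n (L_coords w n c *\<^sub>v x) = Lform n x"
proof -
  have cc: "c \<in> carrier_mat (2*n+1) (2*n+1)" using c by (rule SO_odd_carrier)
  have "qform n (c *\<^sub>v (Lbasis w n *\<^sub>v x)) = qform n (Lbasis w n *\<^sub>v x)"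
    using c mult_mat_vec_carrier[OF Lbasis_carrier x] unfolding SO_odd_def by blast
  moreover have "L_coords w n c *\<^sub>v x \<in> carrier_vec (2*n+1)"
    using mult_mat_vec_carrier[OF L_coords_carrier[OF cc, where w = w] x] .
  ultimately have "w * Lform n (L_coords w n c *\<^sub>v x) = w * Lform n x"
    using x unfolding mult_vec_Lbasis[OF w_nonzero cc x] by (simp add: qform_Lbasis)
  then show ?thesis using w_nonzero by simp
qed

lemma res_Lform:
  assumes "\<And>i. i < 2*n+1 \<Longrightarrow> t $ i \<in> Oring v"
  shows "res (Lform n t) = (\<Sum>i<n. res (t $ i) * res (t $ (2*n-i)))"
proof -
  have "res (w * (t $ n * t $ n)) = 0"
    using assms[of n] by (simp add: res_mult w_Oring Oring_mult res_w)
  moreover have "(\<Sum>i<n. t $ i * t $ (2*n-i)) \<in> Oring v"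
    using assms by (intro Oring_sum Oring_mult) auto
  moreover have "res (\<Sum>i<n. t $ i * t $ (2*n-i)) = (\<Sum>i<n. res (t $ i) * res (t $ (2*n-i)))"
    using assms by (subst res_sum) (auto intro!: sum.cong Oring_mult res_mult)
  ultimately show ?thesis
    unfolding Lform_def using assms[of n] by (subst res_add) (auto intro: Oring_mult w_Oring)
qed

text \<open>Lift a residue vector to O, apply L_coords c, and reduce again: the hyperbolic part of
  Lform is preserved, while the summand w t_n^2 dies modulo p.\<close>

lemma reduced_L_coords_preserves:
  assumes c: "c \<in> SO_odd n" and cL: "(\<lambda>x. c *\<^sub>v x) ` lattice_L v n \<subseteq> lattice_L v n"
    and y: "y \<in> carrier_vec (2*n+1)"
  defines "A \<equiv> map_mat res (L_coords w n c)"
  shows "(\<Sum>i<n. (A *\<^sub>v y) $ i * (A *\<^sub>v y) $ (2*n-i)) = (\<Sum>i<n. y $ i * y $ (2*n-i))"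
proof -
  have cc: "c \<in> carrier_mat (2*n+1) (2*n+1)" using c by (rule SO_odd_carrier)
  let ?M = "L_coords w n c"
  have MO: "?M $$ (i, j) \<in> Oring v" if "i < 2*n+1" "j < 2*n+1" for i j
    using L_coords_integral[OF cc cL that] .
  define x where "x = vec (2*n+1) (\<lambda>i. SOME a. a \<in> Oring v \<and> res a = y $ i)"
  have xO: "x $ i \<in> Oring v" and res_x: "res (x $ i) = y $ i" if "i < 2*n+1" for i
    using someI_ex[OF res_surj[of "y $ i", unfolded Bex_def]] that unfolding x_def by auto
  have x: "x \<in> carrier_vec (2*n+1)" unfolding x_def by simp
  have uO: "(?M *\<^sub>v x) $ i \<in> Oring v" and res_u: "res ((?M *\<^sub>v x) $ i) = (A *\<^sub>v y) $ i"
    if i: "i < 2*n+1" for i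
  proof -
    have u: "(?M *\<^sub>v x) $ i = (\<Sum>k = 0..<2*n+1. ?M $$ (i, k) * x $ k)"
      using L_coords_carrier[OF cc] x i by (simp add: scalar_prod_def)
    show "(?M *\<^sub>v x) $ i \<in> Oring v" unfolding u using MO i xO by (intro Oring_sum Oring_mult) auto
    have "res ((?M *\<^sub>v x) $ i) = (\<Sum>k = 0..<2*n+1. res (?M $$ (i, k) * x $ k))"
      unfolding u using MO i xO by (intro res_sum Oring_mult) auto
    also have "\<dots> = (\<Sum>k = 0..<2*n+1. res (?M $$ (i, k)) * res (x $ k))"
      using MO i xO by (intro sum.cong refl res_mult) auto
    also have "\<dots> = (A *\<^sub>v y) $ i"
      using L_coords_carrier[OF cc] y i res_x by (simp add: A_def scalar_prod_def)
    finally show "res ((?M *\<^sub>v x) $ i) = (A *\<^sub>v y) $ i" .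
  qed
  have "(\<Sum>i<n. (A *\<^sub>v y) $ i * (A *\<^sub>v y) $ (2*n-i)) = res (Lform n (?M *\<^sub>v x))"
    using uO res_u by (simp add: res_Lform)
  also have "\<dots> = res (Lform n x)" using Lform_L_coords[OF c x] by simp
  also have "\<dots> = (\<Sum>i<n. y $ i * y $ (2*n-i))" using xO res_x by (simp add: res_Lform)
  finally show ?thesis .
qed

lemma reduction_preserves_hquad:
  assumes c: "c \<in> SO_odd n" and cL: "(\<lambda>x. c *\<^sub>v x) ` lattice_L v n \<subseteq> lattice_L v n"
    and y: "y \<in> carrier_vec (2*n)"
  shows "hquad n (($) (mat_delete (map_mat res (L_coords w n c)) n n *\<^sub>v y)) = hquad n (($) y)"
proof -
  let ?A = "map_mat res (L_coords w n c)"
  let ?y = "vec (Suc (2*n)) (\<lambda>k. if k = n then 0 else y $ delete_index n k)"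
  have A: "?A \<in> carrier_mat (Suc (2*n)) (Suc (2*n))"
    using L_coords_carrier[OF SO_odd_carrier[OF c]] by simp
  have ins: "insert_index n i = i" "insert_index n (2*n-1-i) = 2*n-i" if "i < n" for i
    using that by (auto simp: insert_index_def)
  have Ay: "(mat_delete ?A n n *\<^sub>v y) $ i = (?A *\<^sub>v ?y) $ insert_index n i" if "i < 2*n" for i
    by (rule index_mat_delete_mult_vec[OF A y _ that]) simp
  have "hquad n (($) (mat_delete ?A n n *\<^sub>v y)) = (\<Sum>i<n. (?A *\<^sub>v ?y) $ i * (?A *\<^sub>v ?y) $ (2*n-i))"
    unfolding hquad_def using Ay ins by (intro sum.cong) auto
  also have "\<dots> = (\<Sum>i<n. ?y $ i * ?y $ (2*n-i))"
    using reduced_L_coords_preserves[OF c cL] by simp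
  also have "\<dots> = hquad n (($) y)"
    unfolding hquad_def by (intro sum.cong) (auto simp: delete_index_def)
  finally show ?thesis .
qed

lemma hyp_orth_upper_reduction:
  assumes c: "c \<in> SO_odd n" and cL: "(\<lambda>x. c *\<^sub>v x) ` lattice_L v n \<subseteq> lattice_L v n"
    and ut: "upper_triangular c"
  shows "hyp_orth_upper n (mat_delete (map_mat res (L_coords w n c)) n n)"
proof -
  let ?A = "map_mat res (L_coords w n c)"
  have cc: "c \<in> carrier_mat (2*n+1) (2*n+1)" using c by (rule SO_odd_carrier)
  have A: "?A \<in> carrier_mat (Suc (2*n)) (Suc (2*n))"
    using L_coords_carrier[OF cc, where w = w] by simp
  have "upper_triangular (mat_delete ?A n n)"
  proof (rule upper_triangularI)
    fix i j assume "j < i" "i < dim_row (mat_delete ?A n n)"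
    then have ji: "j < i" and i: "i < 2*n" by auto
    have ins: "insert_index n j < insert_index n i" "insert_index n i < 2*n+1"
      using ji i by (auto simp: insert_index_def)
    have "mat_delete ?A n n $$ (i, j) = res (L_coords w n c $$ (insert_index n i, insert_index n j))"
      using mat_delete_index[OF A _ _ i, of n n j] ji i ins by simp
    also have "\<dots> = 0"
      using ins ut cc by (simp add: index_L_coords upper_triangular_def)
    finally show "mat_delete ?A n n $$ (i, j) = 0" .
  qed
  moreover have "mat_delete ?A n n \<in> carrier_mat (2*n) (2*n)"
    using mat_delete_carrier[OF A] by simp
  ultimately show ?thesis
    unfolding hyp_orth_upper_def using reduction_preserves_hquad[OF c cL] by blast
qed

text \<open>If g = b j with b in the Borel subgroup and j in J, then b^-1 = j g is an upper triangular
  element of J, so g bar is, up to the transposition coming from g, an upper triangular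
  orthogonal matrix.\<close>

lemma red_bar_Borel_factor:
  assumes n: "0 < n" and b: "b \<in> Borel n" and j: "j \<in> J_stab v n" and g: "swap_elt w n = b * j"
  shows "\<exists>U. hyp_orth_upper n U \<and> red_bar res w n j = U * swaprows_mat (2*n) 0 (2*n-1)"
proof -
  let ?g = "swap_elt w n" and ?N = "2*n+1"
  define c where "c = j * ?g"
  have jS: "j \<in> SO_odd n" and jL: "(\<lambda>x. j *\<^sub>v x) ` lattice_L v n = lattice_L v n"
    using j unfolding J_stab_def by auto
  have bc: "b \<in> carrier_mat ?N ?N" and ut_b: "upper_triangular b"
    using b unfolding Borel_def SO_odd_def by (auto simp: upper_triangular_def)
  have jc: "j \<in> carrier_mat ?N ?N" using jS by (rule SO_odd_carrier)
  have gc: "?g \<in> carrier_mat ?N ?N" by (rule swap_elt_carrier)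
  have gg: "?g * ?g = 1\<^sub>m ?N" by (rule swap_elt_involution[OF n w_nonzero])
  have cc: "c \<in> carrier_mat ?N ?N" unfolding c_def using jc gc by simp
  have cS: "c \<in> SO_odd n" unfolding c_def by (rule SO_odd_mult[OF jS swap_elt_SO[OF n w_nonzero]])
  have cL: "(\<lambda>x. c *\<^sub>v x) ` lattice_L v n = lattice_L v n"
    unfolding c_def by (rule stabilizes_L_mult[OF jc gc jL swap_elt_stabilizes_L[OF n]])
  have "b * c = 1\<^sub>m ?N"
    using bc jc gc gg g unfolding c_def by (metis assoc_mult_mat)
  then have "c * b = 1\<^sub>m ?N" by (rule mat_mult_left_right_inverse[OF bc cc])
  then have ut_c: "upper_triangular c"
    using upper_triangular_left_inverse[OF bc cc ut_b Borel_diag_nonzero[OF b]] by blast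
  have j_eq: "j = c * ?g"
    using jc gc gg unfolding c_def by (simp add: assoc_mult_mat[OF jc gc gc])
  have cO: "\<And>i k. i < ?N \<Longrightarrow> k < ?N \<Longrightarrow> L_coords w n c $$ (i, k) \<in> Oring v"
    using L_coords_integral[OF cc] cL by blast
  have gO: "\<And>i k. i < ?N \<Longrightarrow> k < ?N \<Longrightarrow> L_coords w n ?g $$ (i, k) \<in> Oring v"
    using L_coords_integral[OF gc] swap_elt_stabilizes_L[OF n] by blast
  have "red_bar res w n j = mat_delete (map_mat res (L_coords w n c) * map_mat res (L_coords w n ?g)) n n"
    unfolding red_bar_def L_coords_def[symmetric] j_eq L_coords_mult[OF w_nonzero cc gc]
    using map_mat_res_mult[OF L_coords_carrier[OF cc] L_coords_carrier[OF gc] cO gO] by simp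
  also have "\<dots> = mat_delete (map_mat res (L_coords w n c)) n n * swaprows_mat (2*n) 0 (2*n-1)"
  proof -
    have Ac: "map_mat res (L_coords w n c) \<in> carrier_mat (Suc (2*n)) (Suc (2*n))"
      and Gc: "map_mat res (L_coords w n ?g) \<in> carrier_mat (Suc (2*n)) (Suc (2*n))"
      using L_coords_carrier[OF cc, where w = w] L_coords_carrier[OF gc, where w = w] by simp_all
    have "map_mat res (L_coords w n ?g) $$ (n, k) = 0" if "k < Suc (2*n)" "k \<noteq> n" for k
      using index_reduced_swap_elt[OF n, of n k] that n by (simp add: swap_index_def)
    then have "mat_delete (map_mat res (L_coords w n c) * map_mat res (L_coords w n ?g)) n n
        = mat_delete (map_mat res (L_coords w n c)) n n * mat_delete (map_mat res (L_coords w n ?g)) n n"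
      by (intro mat_delete_mult[OF Ac Gc]) simp_all
    then show ?thesis unfolding reduced_swap_elt[OF n] .
  qed
  finally show ?thesis
    using hyp_orth_upper_reduction[OF cS _ ut_c] cL by blast
qed

end

theorem proposition3p7p9:
  fixes v :: "'a::field_char_0 \<Rightarrow> int" and res :: "'a \<Rightarrow> 'k::field"
    and w :: 'a and n :: nat
  assumes "nonarch_local_field_char0 v res"
    and "w \<noteq> 0" and "v w = 1"
    and "2*n+1 > 1"
  shows "{b * j | b j. b \<in> Borel n \<and> j \<in> J_plus v res w n} \<subset> SO_odd n"
proof -
  interpret nonarch_lf v res w using assms(1-3) by unfold_locales
  have n: "0 < n" using assms(4) by simp
  have "{b * j | b j. b \<in> Borel n \<and> j \<in> J_plus v res w n} \<subseteq> SO_odd n"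
    by (auto simp: Borel_def J_plus_def J_stab_def intro: SO_odd_mult)
  moreover have "swap_elt w n \<notin> {b * j | b j. b \<in> Borel n \<and> j \<in> J_plus v res w n}"
  proof
    assume "swap_elt w n \<in> {b * j | b j. b \<in> Borel n \<and> j \<in> J_plus v res w n}"
    then obtain b j where b: "b \<in> Borel n" and j: "j \<in> J_plus v res w n"
      and g: "swap_elt w n = b * j" by blast
    obtain U where U: "hyp_orth_upper n U"
      and red: "red_bar res w n j = U * swaprows_mat (2*n) 0 (2*n-1)"
      using red_bar_Borel_factor[OF n b _ g] j unfolding J_plus_def by blast
    have "\<not> (if (2::'k) \<noteq> 0 then det (red_bar res w n j) = 1
        else dickson_inv (2*n) (red_bar res w n j) = 0)"
      unfolding red by (rule alpha_hyp_orth_upper_swap_nontrivial[OF finite_residue_field n U])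
    then show False using j unfolding J_plus_def by blast
  qed
  ultimately show ?thesis using swap_elt_SO[OF n assms(2)] by blast
qed

end
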